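(* Let $\mathcal{C}$ be a category with chosen pushouts, let $(\mathcal{E}, \mathcal{M})$ be an orthogonal factorisation system on $\mathcal{C}$, and let $(M, \iota)$ be an idempotent comonad on $\mathcal{C}$ such that $M \colon \mathcal{C} \to \mathcal{C}$ preserves pushouts. Let $(L, E, R)$, $\epsilon$, $\eta$, $\mu$ and $\Delta$ be the data constructed from these in the context. Then the pair $(L, R)$, with this data, is an algebraic weak factorisation system on $\mathcal{C}$.
   Context: Orthogonal factorisation system: two classes $\mathcal{E}, \mathcal{M}$ of morphisms of $\mathcal{C}$, both containing the isomorphisms and closed under composition, such that every morphism factors as $m \circ e$ with $e \in \mathcal{E}$, $m \in \mathcal{M}$, and such that for every commutative square $m \circ f = g \circ e$ with $e \in \mathcal{E}$, $m \in \mathcal{M}$ there is a unique $h$ with $h \circ e = f$ and $m \circ h = g$ (orthogonality). A choice of $(\mathcal{E},\mathcal{M})$-factorisations is fixed. $(M,\iota)$ denotes an idempotent comonad with counit $\iota \colon M \Rightarrow 1$, so that each $M\iota_A$ is invertible. $\mathcal{C}^{\mathbf{2}}$ is the arrow category: objects are morphisms of $\mathcal{C}$; a morphism $\langle h, k\rangle \colon f \to g$, for $f \colon A \to B$ and $g \colon C \to D$, is a pair $h \colon A \to C$, $k \colon B \to D$ with $k \circ f = g \circ h$. Construction of $T$ and $\nu$. For $f \colon A \to B$, let $f \circ \iota_A = Tf \circ Sf$ be the chosen factorisation, with $Sf \colon MA \to Jf$ in $\mathcal{E}$ and $Tf \colon Jf \to B$ in $\mathcal{M}$. For $\langle h,k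 \rangle \colon f \to g$, $J\langle h,k\rangle \colon Jf \to Jg$ is the unique morphism with $J\langle h,k\rangle \circ Sf = Sg \circ Mh$ and $Tg \circ J\langle h,k\rangle = k \circ Tf$. Let $\nu_f \colon JTf \to Jf$ be the unique morphism with $\nu_f \circ STf = \iota_{Jf}$ and $Tf \circ \nu_f = T^2 f$. Construction of $(L,E,R)$. For $f \colon A \to B$, let $Ef$ be the chosen pushout of $\iota_A \colon MA \to A$ and $Sf \colon MA \to Jf$, with injections $Lf \colon A \to Ef$ and $\alpha_f \colon Jf \to Ef$ (so $Lf \circ \iota_A = \alpha_f \circ Sf$), and let $Rf \colon Ef \to B$ be the unique morphism with $Rf \circ Lf = f$ and $Rf \circ \alpha_f = Tf$. For $\langle h,k\rangle \colon f \to g$, $E\langle h,k\rangle \colon Ef \to Eg$ is the unique morphism with $E\langle h,k\rangle \circ Lf = Lg \circ h$ and $E\langle h,k\rangle \circ \alpha_f = \alpha_g \circ J\langle h,k\rangle$. On morphisms, $L\langle h,k\rangle = \langle h, E\langle h,k\rangle\rangle$ and $R\langle h,k\rangle = \langle E\langle h,k\rangle, k\rangle$. Counit and unit: $\epsilon \colon L \Rightarrow 1$ has component $\epsilon_f = \langle 1_A, Rf\rangle \colon Lf \to f$, and $\eta \colon 1 \Rightarrow R$ has component $\eta_f = \langle Lf, 1_B\rangle \colon f \to Rf$. Multiplication: since $M\alpha_f$ is invertible, so is $J\langle \alpha_f, 1_B\rangle \colon JTf \to JRf$. Let $\mu_f \colon ERf \to Ef$ be the unique morphism with $\mu_f \circ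 LRf = 1_{Ef}$ and $\mu_f \circ \alpha_{Rf} = \alpha_f \circ \nu_f \circ J\langle \alpha_f, 1_B\rangle^{-1}$; the component of $\mu \colon R^2 \Rightarrow R$ at $f$ is $\langle \mu_f, 1_B\rangle$. Comultiplication: let $\delta_f \colon Jf \to JLf$ be the unique morphism with $\delta_f \circ Sf = SLf$ and $TLf \circ \delta_f = \alpha_f$. Let $\Delta_f \colon Ef \to ELf$ be the unique morphism with $\Delta_f \circ Lf = L^2 f$ and $\Delta_f \circ \alpha_f = \alpha_{Lf} \circ \delta_f$; the component of $\Delta \colon L \Rightarrow L^2$ at $f$ is $\langle 1_A, \Delta_f\rangle$. Functorial factorisation: a section $(L,E,R) \colon \mathcal{C}^{\mathbf{2}} \to \mathcal{C}^{\mathbf{3}}$ of the composition functor $\mathcal{C}^{\mathbf{3}} \to \mathcal{C}^{\mathbf{2}}$ (where $\mathcal{C}^{\mathbf{3}}$ is the category of composable pairs of morphisms); it sends $f \colon A \to B$ to $A \xrightarrow{Lf} Ef \xrightarrow{Rf} B$. Algebraic weak factorisation system $(L,R)$ on $\mathcal{C}$: (i) a functorial factorisation $(L,E,R)$ on $\mathcal{C}$; (ii) an extension of the copointed endofunctor $(L,\epsilon)$ to a comonad $(L,\epsilon,\Delta)$ on $\mathcal{C}^{\mathbf{2}}$; (iii) an extension of the pointed endofunctor $(R,\eta)$ to a monad $(R,\eta,\mu)$ on $\mathcal{C}^{\mathbf{2}}$; (iv) such that there is a distributive law $\lambda \colon LR \Rightarrow RL$ of the comonad $L$ over the monad $R$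 with components $\lambda_f = \langle \Delta_f, \mu_f\rangle \colon LRf \to RLf$. *)

theory Defs
  imports Main
begin

section \<open>Categories, functors and natural transformations\<close>

text \<open>Composition is written in application order: \<open>g \<cdot> f\<close> is ``\<open>g\<close> after \<open>f\<close>''. Values of the
  operations outside the carriers, or on non-composable pairs, are irrelevant.\<close>

record ('o, 'm) cat =
  Ob :: "'o set"
  Ar :: "'m set"
  Dom :: "'m \<Rightarrow> 'o"
  Cod :: "'m \<Rightarrow> 'o"
  Idt :: "'o \<Rightarrow> 'm"
  Comp :: "'m \<Rightarrow> 'm \<Rightarrow> 'm"  (infixr "\<cdot>\<index>" 70)

definition hom :: "('o, 'm) cat \<Rightarrow> 'o \<Rightarrow> 'o \<Rightarrow> 'm set" where
  "hom C A B = {f \<in> Ar C. Dom C f = A \<and> Cod C f = B}"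

locale category =
  fixes C :: "('o, 'm) cat" (structure)
  assumes dom_in: "f \<in> Ar C \<Longrightarrow> Dom C f \<in> Ob C"
    and cod_in: "f \<in> Ar C \<Longrightarrow> Cod C f \<in> Ob C"
    and ident_in: "A \<in> Ob C \<Longrightarrow> Idt C A \<in> hom C A A"
    and comp_in: "f \<in> Ar C \<Longrightarrow> g \<in> Ar C \<Longrightarrow> Cod C f = Dom C g \<Longrightarrow> g \<cdot> f \<in> hom C (Dom C f) (Cod C g)"
    and comp_ident: "f \<in> Ar C \<Longrightarrow> f \<cdot> Idt C (Dom C f) = f"
    and ident_comp: "f \<in> Ar C \<Longrightarrow> Idt C (Cod C f) \<cdot> f = f"
    and comp_assoc: "f \<in> Ar C \<Longrightarrow> g \<in> Ar C \<Longrightarrow> h \<in> Ar C \<Longrightarrow>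
      Cod C f = Dom C g \<Longrightarrow> Cod C g = Dom C h \<Longrightarrow> (h \<cdot> g) \<cdot> f = h \<cdot> (g \<cdot> f)"

definition inverse_arrows :: "('o, 'm) cat \<Rightarrow> 'm \<Rightarrow> 'm \<Rightarrow> bool" where
  "inverse_arrows C f g \<longleftrightarrow> f \<in> Ar C \<and> g \<in> hom C (Cod C f) (Dom C f) \<and>
     g \<cdot>\<^bsub>C\<^esub> f = Idt C (Dom C f) \<and> f \<cdot>\<^bsub>C\<^esub> g = Idt C (Cod C f)"

definition iso_arrow :: "('o, 'm) cat \<Rightarrow> 'm \<Rightarrow> bool" where
  "iso_arrow C f \<longleftrightarrow> (\<exists>g. inverse_arrows C f g)"

definition inverse_arrow :: "('o, 'm) cat \<Rightarrow> 'm \<Rightarrow> 'm" where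
  "inverse_arrow C f = (THE g. inverse_arrows C f g)"

record ('o1, 'm1, 'o2, 'm2) ftor =
  fob :: "'o1 \<Rightarrow> 'o2"
  far :: "'m1 \<Rightarrow> 'm2"

locale is_functor = dom: category C + cod: category D
  for C :: "('o1, 'm1) cat" and D :: "('o2, 'm2) cat" +
  fixes F :: "('o1, 'm1, 'o2, 'm2) ftor"
  assumes ob_in: "A \<in> Ob C \<Longrightarrow> fob F A \<in> Ob D"
    and ar_in: "f \<in> Ar C \<Longrightarrow> far F f \<in> hom D (fob F (Dom C f)) (fob F (Cod C f))"
    and preserves_ident: "A \<in> Ob C \<Longrightarrow> far F (Idt C A) = Idt D (fob F A)"
    and preserves_comp: "f \<in> Ar C \<Longrightarrow> g \<in> Ar C \<Longrightarrow> Cod C f = Dom C g \<Longrightarrow>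
      far F (g \<cdot>\<^bsub>C\<^esub> f) = far F g \<cdot>\<^bsub>D\<^esub> far F f"

definition id_ftor :: "('o, 'm, 'o, 'm) ftor" where
  "id_ftor = \<lparr>fob = (\<lambda>A. A), far = (\<lambda>f. f)\<rparr>"

definition comp_ftor ::
  "('o2, 'm2, 'o3, 'm3) ftor \<Rightarrow> ('o1, 'm1, 'o2, 'm2) ftor \<Rightarrow> ('o1, 'm1, 'o3, 'm3) ftor"
  (infixr "\<circ>\<^sub>F" 75) where
  "G \<circ>\<^sub>F F = \<lparr>fob = (\<lambda>A. fob G (fob F A)), far = (\<lambda>f. far G (far F f))\<rparr>"

text \<open>A natural transformation is given by its components, indexed by the objects of the source
  category.\<close>

locale nat_trans = src: is_functor C D F + tgt: is_functor C D G
  for C :: "('o1, 'm1) cat" and D :: "('o2, 'm2) cat"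
    and F :: "('o1, 'm1, 'o2, 'm2) ftor" and G :: "('o1, 'm1, 'o2, 'm2) ftor" +
  fixes \<tau> :: "'o1 \<Rightarrow> 'm2"
  assumes component_in: "A \<in> Ob C \<Longrightarrow> \<tau> A \<in> hom D (fob F A) (fob G A)"
    and naturality: "f \<in> Ar C \<Longrightarrow> far G f \<cdot>\<^bsub>D\<^esub> \<tau> (Dom C f) = \<tau> (Cod C f) \<cdot>\<^bsub>D\<^esub> far F f"


section \<open>Comonads, monads and distributive laws\<close>

locale comonad = counit: nat_trans C C W id_ftor \<epsilon> + comult: nat_trans C C W "W \<circ>\<^sub>F W" \<delta>
  for C :: "('o, 'm) cat" (structure) and W \<epsilon> \<delta> +
  assumes counit_left: "A \<in> Ob C \<Longrightarrow> \<epsilon> (fob W A) \<cdot> \<delta> A = Idt C (fob W A)"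
    and counit_right: "A \<in> Ob C \<Longrightarrow> far W (\<epsilon> A) \<cdot> \<delta> A = Idt C (fob W A)"
    and coassoc: "A \<in> Ob C \<Longrightarrow> \<delta> (fob W A) \<cdot> \<delta> A = far W (\<delta> A) \<cdot> \<delta> A"

locale monad = unit: nat_trans C C id_ftor T \<eta> + mult: nat_trans C C "T \<circ>\<^sub>F T" T \<mu>
  for C :: "('o, 'm) cat" (structure) and T \<eta> \<mu> +
  assumes unit_left: "A \<in> Ob C \<Longrightarrow> \<mu> A \<cdot> \<eta> (fob T A) = Idt C (fob T A)"
    and unit_right: "A \<in> Ob C \<Longrightarrow> \<mu> A \<cdot> far T (\<eta> A) = Idt C (fob T A)"
    and assoc: "A \<in> Ob C \<Longrightarrow> \<mu> A \<cdot> \<mu> (fob T A) = \<mu> A \<cdot> far T (\<mu> A)"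

text \<open>An idempotent comonad is one whose comultiplication is invertible. The comultiplication is
  then determined by the counit, as the inverse of \<open>W\<epsilon>\<close>, so only \<open>(W, \<epsilon>)\<close> is recorded.\<close>

definition idempotent_comonad ::
  "('o, 'm) cat \<Rightarrow> ('o, 'm, 'o, 'm) ftor \<Rightarrow> ('o \<Rightarrow> 'm) \<Rightarrow> bool" where
  "idempotent_comonad C W \<epsilon> \<longleftrightarrow> (\<exists>\<delta>. comonad C W \<epsilon> \<delta> \<and> (\<forall>A \<in> Ob C. iso_arrow C (\<delta> A)))"

text \<open>Distributive law \<open>\<lambda> : W T \<Rightarrow> T W\<close> of a comonad \<open>W\<close> over a monad \<open>T\<close>.\<close>

locale distributive_law = comonad C W \<epsilon> \<delta> + monad C T \<eta> \<mu> + law: nat_trans C C "W \<circ>\<^sub>F T" "T \<circ>\<^sub>F W" l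
  for C :: "('o, 'm) cat" (structure) and W \<epsilon> \<delta> T \<eta> \<mu> l +
  assumes law_unit: "A \<in> Ob C \<Longrightarrow> l A \<cdot> far W (\<eta> A) = \<eta> (fob W A)"
    and law_counit: "A \<in> Ob C \<Longrightarrow> far T (\<epsilon> A) \<cdot> l A = \<epsilon> (fob T A)"
    and law_mult: "A \<in> Ob C \<Longrightarrow>
      l A \<cdot> far W (\<mu> A) = \<mu> (fob W A) \<cdot> far T (l A) \<cdot> l (fob T A)"
    and law_comult: "A \<in> Ob C \<Longrightarrow>
      far T (\<delta> A) \<cdot> l A = l (fob W A) \<cdot> far W (l A) \<cdot> \<delta> (fob T A)"


section \<open>Pushouts and orthogonal factorisation systems\<close>

definition is_pushout :: "('o, 'm) cat \<Rightarrow> 'm \<Rightarrow> 'm \<Rightarrow> 'm \<Rightarrow> 'm \<Rightarrow> bool" where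
  "is_pushout C f g i j \<longleftrightarrow>
     f \<in> Ar C \<and> g \<in> Ar C \<and> i \<in> Ar C \<and> j \<in> Ar C \<and>
     Dom C f = Dom C g \<and> Dom C i = Cod C f \<and> Dom C j = Cod C g \<and> Cod C i = Cod C j \<and>
     i \<cdot>\<^bsub>C\<^esub> f = j \<cdot>\<^bsub>C\<^esub> g \<and>
     (\<forall>u \<in> Ar C. \<forall>v \<in> Ar C.
        Dom C u = Cod C f \<and> Dom C v = Cod C g \<and> Cod C u = Cod C v \<and> u \<cdot>\<^bsub>C\<^esub> f = v \<cdot>\<^bsub>C\<^esub> g \<longrightarrow>
        (\<exists>!w. w \<in> hom C (Cod C i) (Cod C u) \<and> w \<cdot>\<^bsub>C\<^esub> i = u \<and> w \<cdot>\<^bsub>C\<^esub> j = v))"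

definition chosen_pushouts ::
  "('o, 'm) cat \<Rightarrow> ('m \<Rightarrow> 'm \<Rightarrow> 'm) \<Rightarrow> ('m \<Rightarrow> 'm \<Rightarrow> 'm) \<Rightarrow> bool" where
  "chosen_pushouts C inj_l inj_r \<longleftrightarrow>
     (\<forall>f \<in> Ar C. \<forall>g \<in> Ar C. Dom C f = Dom C g \<longrightarrow> is_pushout C f g (inj_l f g) (inj_r f g))"

definition preserves_pushouts ::
  "('o1, 'm1) cat \<Rightarrow> ('o2, 'm2) cat \<Rightarrow> ('o1, 'm1, 'o2, 'm2) ftor \<Rightarrow> bool" where
  "preserves_pushouts C D F \<longleftrightarrow>
     (\<forall>f g i j. is_pushout C f g i j \<longrightarrow> is_pushout D (far F f) (far F g) (far F i) (far F j))"

locale orthogonal_factorisation_system = category C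
  for C :: "('o, 'm) cat" (structure) +
  fixes EE MM :: "'m set"
  assumes EE_sub: "EE \<subseteq> Ar C"
    and MM_sub: "MM \<subseteq> Ar C"
    and iso_EE: "iso_arrow C f \<Longrightarrow> f \<in> EE"
    and iso_MM: "iso_arrow C f \<Longrightarrow> f \<in> MM"
    and comp_EE: "f \<in> EE \<Longrightarrow> g \<in> EE \<Longrightarrow> Cod C f = Dom C g \<Longrightarrow> g \<cdot> f \<in> EE"
    and comp_MM: "f \<in> MM \<Longrightarrow> g \<in> MM \<Longrightarrow> Cod C f = Dom C g \<Longrightarrow> g \<cdot> f \<in> MM"
    and factorisation: "f \<in> Ar C \<Longrightarrow> \<exists>e \<in> EE. \<exists>m \<in> MM. Cod C e = Dom C m \<and> m \<cdot> e = f"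
    and orthogonality: "e \<in> EE \<Longrightarrow> m \<in> MM \<Longrightarrow>
      f \<in> hom C (Dom C e) (Dom C m) \<Longrightarrow> g \<in> hom C (Cod C e) (Cod C m) \<Longrightarrow> m \<cdot> f = g \<cdot> e \<Longrightarrow>
      \<exists>!h. h \<in> hom C (Cod C e) (Dom C m) \<and> h \<cdot> e = f \<and> m \<cdot> h = g"

definition chosen_factorisations ::
  "('o, 'm) cat \<Rightarrow> 'm set \<Rightarrow> 'm set \<Rightarrow> ('m \<Rightarrow> 'm) \<Rightarrow> ('m \<Rightarrow> 'm) \<Rightarrow> bool" where
  "chosen_factorisations C EE MM e_part m_part \<longleftrightarrow>
     (\<forall>f \<in> Ar C. e_part f \<in> EE \<and> m_part f \<in> MM \<and>
        Cod C (e_part f) = Dom C (m_part f) \<and> m_part f \<cdot>\<^bsub>C\<^esub> e_part f = f)"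


section \<open>The categories of arrows and of composable pairs\<close>

text \<open>\<open>Sq f h k g\<close> is the morphism \<open>\<langle>h, k\<rangle> : f \<rightarrow> g\<close> of the arrow category. Similarly
  \<open>Lad p h l k q\<close> is the morphism \<open>\<langle>h, l, k\<rangle> : p \<rightarrow> q\<close> between composable pairs, where a composable
  pair \<open>(f1, f2)\<close> is listed in diagrammatic order \<open>A \<rightarrow> X \<rightarrow> B\<close>.\<close>

datatype 'm sq = Sq (sq_dom: 'm) (sq_top: 'm) (sq_bot: 'm) (sq_cod: 'm)

datatype 'm lad =
  Lad (lad_dom: "'m \<times> 'm") (lad_top: 'm) (lad_mid: 'm) (lad_bot: 'm) (lad_cod: "'m \<times> 'm")

definition arrow_cat :: "('o, 'm) cat \<Rightarrow> ('m, 'm sq) cat" where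
  "arrow_cat C =
     \<lparr>Ob = Ar C,
      Ar = {Sq f h k g | f h k g. f \<in> Ar C \<and> g \<in> Ar C \<and>
              h \<in> hom C (Dom C f) (Dom C g) \<and> k \<in> hom C (Cod C f) (Cod C g) \<and>
              k \<cdot>\<^bsub>C\<^esub> f = g \<cdot>\<^bsub>C\<^esub> h},
      Dom = sq_dom,
      Cod = sq_cod,
      Idt = (\<lambda>f. Sq f (Idt C (Dom C f)) (Idt C (Cod C f)) f),
      Comp = (\<lambda>t s. Sq (sq_dom s) (sq_top t \<cdot>\<^bsub>C\<^esub> sq_top s) (sq_bot t \<cdot>\<^bsub>C\<^esub> sq_bot s) (sq_cod t))\<rparr>"

definition pair_cat :: "('o, 'm) cat \<Rightarrow> ('m \<times> 'm, 'm lad) cat" where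
  "pair_cat C =
     \<lparr>Ob = {(f1, f2). f1 \<in> Ar C \<and> f2 \<in> Ar C \<and> Cod C f1 = Dom C f2},
      Ar = {Lad (f1, f2) h l k (g1, g2) | f1 f2 h l k g1 g2.
              f1 \<in> Ar C \<and> f2 \<in> Ar C \<and> Cod C f1 = Dom C f2 \<and>
              g1 \<in> Ar C \<and> g2 \<in> Ar C \<and> Cod C g1 = Dom C g2 \<and>
              h \<in> hom C (Dom C f1) (Dom C g1) \<and> l \<in> hom C (Cod C f1) (Cod C g1) \<and>
              k \<in> hom C (Cod C f2) (Cod C g2) \<and>
              l \<cdot>\<^bsub>C\<^esub> f1 = g1 \<cdot>\<^bsub>C\<^esub> h \<and> k \<cdot>\<^bsub>C\<^esub> f2 = g2 \<cdot>\<^bsub>C\<^esub> l},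
      Dom = lad_dom,
      Cod = lad_cod,
      Idt = (\<lambda>p. Lad p (Idt C (Dom C (fst p))) (Idt C (Cod C (fst p))) (Idt C (Cod C (snd p))) p),
      Comp = (\<lambda>t s. Lad (lad_dom s) (lad_top t \<cdot>\<^bsub>C\<^esub> lad_top s) (lad_mid t \<cdot>\<^bsub>C\<^esub> lad_mid s)
                        (lad_bot t \<cdot>\<^bsub>C\<^esub> lad_bot s) (lad_cod t))\<rparr>"

definition composition_ftor :: "('o, 'm) cat \<Rightarrow> ('m \<times> 'm, 'm lad, 'm, 'm sq) ftor" where
  "composition_ftor C =
     \<lparr>fob = (\<lambda>(f1, f2). f2 \<cdot>\<^bsub>C\<^esub> f1),
      far = (\<lambda>s. Sq (snd (lad_dom s) \<cdot>\<^bsub>C\<^esub> fst (lad_dom s)) (lad_top s) (lad_bot s)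
                    (snd (lad_cod s) \<cdot>\<^bsub>C\<^esub> fst (lad_cod s)))\<rparr>"

definition first_ftor :: "('m \<times> 'm, 'm lad, 'm, 'm sq) ftor" where
  "first_ftor =
     \<lparr>fob = fst, far = (\<lambda>s. Sq (fst (lad_dom s)) (lad_top s) (lad_mid s) (fst (lad_cod s)))\<rparr>"

definition second_ftor :: "('m \<times> 'm, 'm lad, 'm, 'm sq) ftor" where
  "second_ftor =
     \<lparr>fob = snd, far = (\<lambda>s. Sq (snd (lad_dom s)) (lad_mid s) (lad_bot s) (snd (lad_cod s)))\<rparr>"


section \<open>Algebraic weak factorisation systems\<close>

locale functorial_factorisation = base: category C + is_functor "arrow_cat C" "pair_cat C" FF
  for C :: "('o, 'm) cat" and FF :: "('m, 'm sq, 'm \<times> 'm, 'm lad) ftor" +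
  assumes section_ob: "f \<in> Ob (arrow_cat C) \<Longrightarrow> fob (composition_ftor C \<circ>\<^sub>F FF) f = f"
    and section_ar: "s \<in> Ar (arrow_cat C) \<Longrightarrow> far (composition_ftor C \<circ>\<^sub>F FF) s = s"

text \<open>The copointed endofunctor \<open>(L, \<epsilon>)\<close> and the pointed endofunctor \<open>(R, \<eta>)\<close> of a functorial
  factorisation.\<close>

definition left_ftor :: "('m, 'm sq, 'm \<times> 'm, 'm lad) ftor \<Rightarrow> ('m, 'm sq, 'm, 'm sq) ftor" where
  "left_ftor FF = first_ftor \<circ>\<^sub>F FF"

definition right_ftor :: "('m, 'm sq, 'm \<times> 'm, 'm lad) ftor \<Rightarrow> ('m, 'm sq, 'm, 'm sq) ftor" where
  "right_ftor FF = second_ftor \<circ>\<^sub>F FF"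

definition left_counit ::
  "('o, 'm) cat \<Rightarrow> ('m, 'm sq, 'm \<times> 'm, 'm lad) ftor \<Rightarrow> 'm \<Rightarrow> 'm sq" where
  "left_counit C FF f = Sq (fob (left_ftor FF) f) (Idt C (Dom C f)) (fob (right_ftor FF) f) f"

definition right_unit ::
  "('o, 'm) cat \<Rightarrow> ('m, 'm sq, 'm \<times> 'm, 'm lad) ftor \<Rightarrow> 'm \<Rightarrow> 'm sq" where
  "right_unit C FF f = Sq f (fob (left_ftor FF) f) (Idt C (Cod C f)) (fob (right_ftor FF) f)"

text \<open>\<open>Delta\<close> and \<open>mu\<close> are families of squares; the morphisms \<open>\<Delta>\<^sub>f\<close> and \<open>\<mu>\<^sub>f\<close> of the base category
  entering the distributive law \<open>\<langle>\<Delta>\<^sub>f, \<mu>\<^sub>f\<rangle> : L R f \<rightarrow> R L f\<close> are the lower side of the former and the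
  upper side of the latter.\<close>

locale awfs = functorial_factorisation C FF
  for C :: "('o, 'm) cat" and FF :: "('m, 'm sq, 'm \<times> 'm, 'm lad) ftor" +
  fixes Delta :: "'m \<Rightarrow> 'm sq" and mu :: "'m \<Rightarrow> 'm sq"
  assumes left_comonad: "comonad (arrow_cat C) (left_ftor FF) (left_counit C FF) Delta"
    and right_monad: "monad (arrow_cat C) (right_ftor FF) (right_unit C FF) mu"
    and distributive: "distributive_law (arrow_cat C)
      (left_ftor FF) (left_counit C FF) Delta (right_ftor FF) (right_unit C FF) mu
      (\<lambda>f. Sq (fob (left_ftor FF) (fob (right_ftor FF) f)) (sq_bot (Delta f)) (sq_top (mu f))
              (fob (right_ftor FF) (fob (left_ftor FF) f)))"


section \<open>The construction\<close>

text \<open>The locale makes no assumptions; it only fixes the data, namely a category \<open>C\<close>, the two halves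
  of the chosen factorisations, the two injections of the chosen pushouts, and \<open>(M, \<iota>)\<close>. Suffixes
  \<open>_ob\<close> and \<open>_ar\<close> distinguish the actions of \<open>J\<close> and \<open>E\<close> on objects and on morphisms of the arrow
  category.\<close>

locale awfs_construction =
  fixes C :: "('o, 'm) cat" (structure)
    and e_part m_part :: "'m \<Rightarrow> 'm"
    and inj_l inj_r :: "'m \<Rightarrow> 'm \<Rightarrow> 'm"
    and M :: "('o, 'm, 'o, 'm) ftor"
    and \<iota> :: "'o \<Rightarrow> 'm"
begin

definition S :: "'m \<Rightarrow> 'm" where
  "S f = e_part (f \<cdot> \<iota> (Dom C f))"

definition T :: "'m \<Rightarrow> 'm" where
  "T f = m_part (f \<cdot> \<iota> (Dom C f))"

definition J_ob :: "'m \<Rightarrow> 'o" where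
  "J_ob f = Cod C (S f)"

definition J_ar :: "'m sq \<Rightarrow> 'm" where
  "J_ar s = (THE j. j \<in> hom C (J_ob (sq_dom s)) (J_ob (sq_cod s)) \<and>
     j \<cdot> S (sq_dom s) = S (sq_cod s) \<cdot> far M (sq_top s) \<and>
     T (sq_cod s) \<cdot> j = sq_bot s \<cdot> T (sq_dom s))"

definition nu :: "'m \<Rightarrow> 'm" where
  "nu f = (THE n. n \<in> hom C (J_ob (T f)) (J_ob f) \<and>
     n \<cdot> S (T f) = \<iota> (J_ob f) \<and> T f \<cdot> n = T (T f))"

definition L :: "'m \<Rightarrow> 'm" where
  "L f = inj_l (\<iota> (Dom C f)) (S f)"

definition alpha :: "'m \<Rightarrow> 'm" where
  "alpha f = inj_r (\<iota> (Dom C f)) (S f)"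

definition E_ob :: "'m \<Rightarrow> 'o" where
  "E_ob f = Cod C (L f)"

definition R :: "'m \<Rightarrow> 'm" where
  "R f = (THE r. r \<in> hom C (E_ob f) (Cod C f) \<and> r \<cdot> L f = f \<and> r \<cdot> alpha f = T f)"

definition E_ar :: "'m sq \<Rightarrow> 'm" where
  "E_ar s = (THE e. e \<in> hom C (E_ob (sq_dom s)) (E_ob (sq_cod s)) \<and>
     e \<cdot> L (sq_dom s) = L (sq_cod s) \<cdot> sq_top s \<and>
     e \<cdot> alpha (sq_dom s) = alpha (sq_cod s) \<cdot> J_ar s)"

definition LER :: "('m, 'm sq, 'm \<times> 'm, 'm lad) ftor" where
  "LER =
     \<lparr>fob = (\<lambda>f. (L f, R f)),
      far = (\<lambda>s. Lad (L (sq_dom s), R (sq_dom s)) (sq_top s) (E_ar s) (sq_bot s)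
                     (L (sq_cod s), R (sq_cod s)))\<rparr>"

definition mu_ar :: "'m \<Rightarrow> 'm" where
  "mu_ar f = (THE m. m \<in> hom C (E_ob (R f)) (E_ob f) \<and>
     m \<cdot> L (R f) = Idt C (E_ob f) \<and>
     m \<cdot> alpha (R f) =
       alpha f \<cdot> nu f \<cdot> inverse_arrow C (J_ar (Sq (T f) (alpha f) (Idt C (Cod C f)) (R f))))"

definition mu :: "'m \<Rightarrow> 'm sq" where
  "mu f = Sq (R (R f)) (mu_ar f) (Idt C (Cod C f)) (R f)"

definition delta :: "'m \<Rightarrow> 'm" where
  "delta f = (THE d. d \<in> hom C (J_ob f) (J_ob (L f)) \<and>
     d \<cdot> S f = S (L f) \<and> T (L f) \<cdot> d = alpha f)"

definition Delta_ar :: "'m \<Rightarrow> 'm" where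
  "Delta_ar f = (THE d. d \<in> hom C (E_ob f) (E_ob (L f)) \<and>
     d \<cdot> L f = L (L f) \<and> d \<cdot> alpha f = alpha (L f) \<cdot> delta f)"

definition Delta :: "'m \<Rightarrow> 'm sq" where
  "Delta f = Sq (L f) (Idt C (Dom C f)) (Delta_ar f) (L (L f))"

end

end

theory Submission
  imports Defs
begin

text \<open>A map out of \<open>Ef\<close> is determined by its composites with \<open>Lf\<close> and \<open>\<alpha>\<^sub>f\<close>, and a map out of \<open>Jf\<close>
  by its composites with \<open>Sf\<close> and with some arrow of \<open>\<M>\<close>. As \<open>M\<close> preserves the pushout defining
  \<open>Ef\<close> and inverts \<open>\<iota>\<close>, the arrow \<open>M\<alpha>\<^sub>f\<close> is invertible, so for maps out of \<open>JRf\<close> the composite with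
  \<open>SRf \<cdot> M\<alpha>\<^sub>f\<close> suffices in place of that with \<open>SRf\<close>. The map \<open>\<kappa>\<^sub>f = \<nu>\<^sub>f \<cdot> J\<langle>\<alpha>\<^sub>f, 1\<rangle>\<^sup>-\<^sup>1\<close> is thereby
  characterised by \<open>\<kappa>\<^sub>f \<cdot> SRf \<cdot> M\<alpha>\<^sub>f = \<iota>\<close> and \<open>Tf \<cdot> \<kappa>\<^sub>f = TRf\<close>. Each law for \<open>\<mu>\<close> and \<open>\<Delta>\<close> reduces along
  the pushout to an identity between \<open>\<kappa>\<close>, \<open>\<delta>\<close> and \<open>J\<close>, which follows from these characterisations and
  the naturality of \<open>\<iota>\<close>.\<close>

section \<open>Arrow categories and functors\<close>

context category
begin

lemma comp_types [simp]:
  assumes "f \<in> Ar C" "g \<in> Ar C" "Cod C f = Dom C g"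
  shows "g \<cdot> f \<in> Ar C" "Dom C (g \<cdot> f) = Dom C f" "Cod C (g \<cdot> f) = Cod C g"
  using comp_in[OF assms] by (auto simp: hom_def)

lemma ident_types [simp]:
  assumes "A \<in> Ob C"
  shows "Idt C A \<in> Ar C" "Dom C (Idt C A) = A" "Cod C (Idt C A) = A"
  using ident_in[OF assms] by (auto simp: hom_def)

lemma comp_ident' [simp]: "f \<in> Ar C \<Longrightarrow> Dom C f = A \<Longrightarrow> f \<cdot> Idt C A = f"
  using comp_ident by auto

lemma ident_comp' [simp]: "f \<in> Ar C \<Longrightarrow> Cod C f = A \<Longrightarrow> Idt C A \<cdot> f = f"
  using ident_comp by auto

text \<open>Composites are normalised by bracketing to the right, so the left side
  \<open>g \<cdot> f\<close> of an equation is no longer a subterm once some \<open>x\<close>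
  precedes it. This form with a tail restores the equation as a rewrite rule.\<close>

lemma comp_reassoc:
  "g \<cdot> f = k \<Longrightarrow> g \<in> Ar C \<Longrightarrow> f \<in> Ar C \<Longrightarrow> Cod C f = Dom C g \<Longrightarrow>
    x \<in> Ar C \<Longrightarrow> Cod C x = Dom C f \<Longrightarrow> g \<cdot> (f \<cdot> x) = k \<cdot> x"
  using comp_assoc by metis

declare dom_in [simp] cod_in [simp] comp_assoc [simp]

section \<open>Inverses, and pushouts of invertible arrows\<close>

lemma inverse_arrows_unique:
  assumes "inverse_arrows C f g" "inverse_arrows C f g'"
  shows "g = g'"
  using assms comp_assoc[of g f g']
  by (auto simp: inverse_arrows_def hom_def simp del: comp_assoc)

lemma inverse_arrow_eqI: "inverse_arrows C f g \<Longrightarrow> inverse_arrow C f = g"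
  unfolding inverse_arrow_def using inverse_arrows_unique by blast

lemma inverse_arrow_types [simp]:
  assumes "iso_arrow C f"
  shows "f \<in> Ar C" "inverse_arrow C f \<in> Ar C"
    "Dom C (inverse_arrow C f) = Cod C f" "Cod C (inverse_arrow C f) = Dom C f"
    "inverse_arrow C f \<cdot> f = Idt C (Dom C f)" "f \<cdot> inverse_arrow C f = Idt C (Cod C f)"
  using assms inverse_arrow_eqI by (auto simp: iso_arrow_def inverse_arrows_def hom_def)

lemma iso_arrow_epi:
  assumes "iso_arrow C f" "u \<in> Ar C" "v \<in> Ar C" "Dom C u = Cod C f" "Dom C v = Cod C f"
    and eq: "u \<cdot> f = v \<cdot> f"
  shows "u = v"
proof -
  have "(u \<cdot> f) \<cdot> inverse_arrow C f = (v \<cdot> f) \<cdot> inverse_arrow C f"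
    by (simp add: eq)
  then show ?thesis using assms(1-5) by simp
qed

lemma pushout_ex1:
  assumes "is_pushout C f g i j" "u \<in> Ar C" "v \<in> Ar C"
    and "Dom C u = Cod C f" "Dom C v = Cod C g" "Cod C u = X" "Cod C v = X" "u \<cdot> f = v \<cdot> g"
  shows "\<exists>!w. w \<in> hom C (Cod C i) X \<and> w \<cdot> i = u \<and> w \<cdot> j = v"
proof -
  have po: "\<forall>u \<in> Ar C. \<forall>v \<in> Ar C.
      Dom C u = Cod C f \<and> Dom C v = Cod C g \<and> Cod C u = Cod C v \<and> u \<cdot> f = v \<cdot> g \<longrightarrow>
      (\<exists>!w. w \<in> hom C (Cod C i) (Cod C u) \<and> w \<cdot> i = u \<and> w \<cdot> j = v)"
    using assms(1) unfolding is_pushout_def by (elim conjE)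
  show ?thesis
    using mp[OF bspec[OF bspec[OF po assms(2)] assms(3)]] assms(4-8) by simp
qed

text \<open>The inverse of \<open>j\<close> is the map \<open>w\<close> that
  \<open>g \<cdot> f'\<close> and an identity induce out of the pushout. That
  \<open>j \<cdot> w\<close> is an identity as well follows from uniqueness, both having the same
  composites with \<open>i\<close> and \<open>j\<close>.\<close>

lemma pushout_of_iso:
  assumes po: "is_pushout C f g i j" and iso: "iso_arrow C f"
  shows "iso_arrow C j"
proof -
  define f' where "f' = inverse_arrow C f"
  have ty [simp]: "f \<in> Ar C" "g \<in> Ar C" "i \<in> Ar C" "j \<in> Ar C" "Dom C f = Dom C g"
    "Dom C i = Cod C f" "Dom C j = Cod C g" "Cod C i = Cod C j"
    and sq: "i \<cdot> f = j \<cdot> g"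
    using po by (auto simp: is_pushout_def)
  have f' [simp]: "f' \<in> Ar C" "Dom C f' = Cod C f" "Cod C f' = Dom C g"
    "f' \<cdot> f = Idt C (Dom C g)" "f \<cdot> f' = Idt C (Cod C f)"
    using iso by (simp_all add: f'_def)
  obtain w where w: "w \<in> hom C (Cod C i) (Cod C g)" "w \<cdot> i = g \<cdot> f'" "w \<cdot> j = Idt C (Cod C g)"
    using pushout_ex1[OF po, of "g \<cdot> f'" "Idt C (Cod C g)" "Cod C g"] by auto
  have w_ty [simp]: "w \<in> Ar C" "Dom C w = Cod C j" "Cod C w = Cod C g"
    using w(1) by (auto simp: hom_def)
  have ex1: "\<exists>!v. v \<in> hom C (Cod C i) (Cod C i) \<and> v \<cdot> i = i \<and> v \<cdot> j = j"
    by (rule pushout_ex1[OF po]) (simp_all add: sq)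
  have "(j \<cdot> w) \<cdot> i = (j \<cdot> g) \<cdot> f'" by (simp add: w)
  also have "\<dots> = (i \<cdot> f) \<cdot> f'" by (simp only: sq)
  also have "\<dots> = i" by simp
  finally have "(j \<cdot> w) \<cdot> i = i" .
  moreover have "(j \<cdot> w) \<cdot> j = j" by (simp add: w)
  moreover have "j \<cdot> w \<in> hom C (Cod C i) (Cod C i)" by (simp add: hom_def)
  moreover have "Idt C (Cod C i) \<in> hom C (Cod C i) (Cod C i)"
    "Idt C (Cod C i) \<cdot> i = i" "Idt C (Cod C i) \<cdot> j = j" by (simp_all add: hom_def)
  ultimately have "j \<cdot> w = Idt C (Cod C i)" using ex1 by blast
  then have "inverse_arrows C j w"
    using w by (simp add: inverse_arrows_def hom_def)
  then show ?thesis by (auto simp: iso_arrow_def)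
qed

section \<open>Squares and ladders as arrows of categories\<close>

lemma square_iff [simp]:
  "Sq f h k g \<in> Ar (arrow_cat C) \<longleftrightarrow> f \<in> Ar C \<and> g \<in> Ar C \<and> h \<in> Ar C \<and> k \<in> Ar C \<and>
    Dom C h = Dom C f \<and> Cod C h = Dom C g \<and> Dom C k = Cod C f \<and> Cod C k = Cod C g \<and>
    k \<cdot> f = g \<cdot> h"
  by (auto simp: arrow_cat_def hom_def)

lemma ladder_iff [simp]:
  "Lad (f1, f2) h l k (g1, g2) \<in> Ar (pair_cat C) \<longleftrightarrow>
    f1 \<in> Ar C \<and> f2 \<in> Ar C \<and> Cod C f1 = Dom C f2 \<and>
    g1 \<in> Ar C \<and> g2 \<in> Ar C \<and> Cod C g1 = Dom C g2 \<and> h \<in> Ar C \<and> l \<in> Ar C \<and> k \<in> Ar C \<and>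
    Dom C h = Dom C f1 \<and> Cod C h = Dom C g1 \<and> Dom C l = Cod C f1 \<and> Cod C l = Cod C g1 \<and>
    Dom C k = Cod C f2 \<and> Cod C k = Cod C g2 \<and> l \<cdot> f1 = g1 \<cdot> h \<and> k \<cdot> f2 = g2 \<cdot> l"
  by (auto simp: pair_cat_def hom_def)

end

lemma arrow_cat_simps [simp]:
  "Ob (arrow_cat C) = Ar C"
  "Dom (arrow_cat C) = sq_dom" "Cod (arrow_cat C) = sq_cod"
  "Idt (arrow_cat C) f = Sq f (Idt C (Dom C f)) (Idt C (Cod C f)) f"
  "Sq f' h' k' g' \<cdot>\<^bsub>arrow_cat C\<^esub> Sq f h k g = Sq f (h' \<cdot>\<^bsub>C\<^esub> h) (k' \<cdot>\<^bsub>C\<^esub> k) g'"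
  by (simp_all add: arrow_cat_def)

lemma pair_cat_simps [simp]:
  "p \<in> Ob (pair_cat C) \<longleftrightarrow> fst p \<in> Ar C \<and> snd p \<in> Ar C \<and> Cod C (fst p) = Dom C (snd p)"
  "Dom (pair_cat C) = lad_dom" "Cod (pair_cat C) = lad_cod"
  "Idt (pair_cat C) p = Lad p (Idt C (Dom C (fst p))) (Idt C (Cod C (fst p))) (Idt C (Cod C (snd p))) p"
  "Lad p' h' l' k' q' \<cdot>\<^bsub>pair_cat C\<^esub> Lad p h l k q =
    Lad p (h' \<cdot>\<^bsub>C\<^esub> h) (l' \<cdot>\<^bsub>C\<^esub> l) (k' \<cdot>\<^bsub>C\<^esub> k) q'"
  by (auto simp: pair_cat_def)

context category
begin

lemma arrow_cat_cases:
  assumes "s \<in> Ar (arrow_cat C)"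
  obtains f h k g where "s = Sq f h k g"
    and "f \<in> Ar C" "g \<in> Ar C" "h \<in> Ar C" "k \<in> Ar C"
    and "Dom C h = Dom C f" "Cod C h = Dom C g" "Dom C k = Cod C f" "Cod C k = Cod C g"
    and "k \<cdot> f = g \<cdot> h"
  using assms by (cases s) auto

lemma pair_cat_cases:
  assumes "s \<in> Ar (pair_cat C)"
  obtains f1 f2 h l k g1 g2 where "s = Lad (f1, f2) h l k (g1, g2)"
    and "f1 \<in> Ar C" "f2 \<in> Ar C" "Cod C f1 = Dom C f2"
    and "g1 \<in> Ar C" "g2 \<in> Ar C" "Cod C g1 = Dom C g2" "h \<in> Ar C" "l \<in> Ar C" "k \<in> Ar C"
    and "Dom C h = Dom C f1" "Cod C h = Dom C g1" "Dom C l = Cod C f1" "Cod C l = Cod C g1"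
    and "Dom C k = Cod C f2" "Cod C k = Cod C g2" "l \<cdot> f1 = g1 \<cdot> h" "k \<cdot> f2 = g2 \<cdot> l"
  using assms by (cases s; cases "lad_dom s"; cases "lad_cod s") auto

lemma hom_squares:
  "Sq f h k g \<in> hom (arrow_cat C) f' g' \<longleftrightarrow> Sq f h k g \<in> Ar (arrow_cat C) \<and> f = f' \<and> g = g'"
  by (auto simp: hom_def)

text \<open>The brackets match the composites of \<open>arrow_cat\<close> and
  \<open>pair_cat\<close>: closure under composition leaves goals of this shape once
  \<open>comp_assoc\<close> is switched off. The same pasting yields the composite squares in
  \<open>J_comp\<close> and \<open>E_comp\<close>.\<close>

lemma comp_paste:
  assumes "k \<cdot> f = g \<cdot> h" "k' \<cdot> g = g' \<cdot> h'"
    and "f \<in> Ar C" "g \<in> Ar C" "h \<in> Ar C" "k \<in> Ar C" "g' \<in> Ar C" "h' \<in> Ar C" "k' \<in> Ar C"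
    and "Cod C f = Dom C k" "Cod C h = Dom C g" "Cod C g = Dom C k'" "Cod C h' = Dom C g'"
    and "Cod C h = Dom C h'" "Cod C k = Dom C k'"
  shows "(k' \<cdot> k) \<cdot> f = g' \<cdot> (h' \<cdot> h)"
proof -
  have "(k' \<cdot> k) \<cdot> f = k' \<cdot> (g \<cdot> h)"
    using assms by simp
  also have "\<dots> = (k' \<cdot> g) \<cdot> h" using assms(3-) by simp
  also have "\<dots> = g' \<cdot> (h' \<cdot> h)" using assms(2-) by simp
  finally show ?thesis .
qed

lemma category_arrow_cat: "category (arrow_cat C)"
proof
  fix s t assume "s \<in> Ar (arrow_cat C)" "t \<in> Ar (arrow_cat C)"
    and "Cod (arrow_cat C) s = Dom (arrow_cat C) t"
  then show "t \<cdot>\<^bsub>arrow_cat C\<^esub> s \<in> hom (arrow_cat C) (Dom (arrow_cat C) s) (Cod (arrow_cat C) t)"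
    by (elim arrow_cat_cases) (auto simp: hom_def simp del: comp_assoc intro!: comp_paste)
next
  fix s t u assume "s \<in> Ar (arrow_cat C)" "t \<in> Ar (arrow_cat C)" "u \<in> Ar (arrow_cat C)"
    and "Cod (arrow_cat C) s = Dom (arrow_cat C) t" "Cod (arrow_cat C) t = Dom (arrow_cat C) u"
  then show "(u \<cdot>\<^bsub>arrow_cat C\<^esub> t) \<cdot>\<^bsub>arrow_cat C\<^esub> s = u \<cdot>\<^bsub>arrow_cat C\<^esub> (t \<cdot>\<^bsub>arrow_cat C\<^esub> s)"
    by (elim arrow_cat_cases) simp
qed (auto simp: hom_def elim: arrow_cat_cases)

lemma category_pair_cat: "category (pair_cat C)"
proof
  fix s t assume "s \<in> Ar (pair_cat C)" "t \<in> Ar (pair_cat C)"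
    and "Cod (pair_cat C) s = Dom (pair_cat C) t"
  then show "t \<cdot>\<^bsub>pair_cat C\<^esub> s \<in> hom (pair_cat C) (Dom (pair_cat C) s) (Cod (pair_cat C) t)"
    by (elim pair_cat_cases) (auto simp: hom_def simp del: comp_assoc intro!: comp_paste)
next
  fix s t u assume "s \<in> Ar (pair_cat C)" "t \<in> Ar (pair_cat C)" "u \<in> Ar (pair_cat C)"
    and "Cod (pair_cat C) s = Dom (pair_cat C) t" "Cod (pair_cat C) t = Dom (pair_cat C) u"
  then show "(u \<cdot>\<^bsub>pair_cat C\<^esub> t) \<cdot>\<^bsub>pair_cat C\<^esub> s = u \<cdot>\<^bsub>pair_cat C\<^esub> (t \<cdot>\<^bsub>pair_cat C\<^esub> s)"
    by (elim pair_cat_cases) simp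
qed (auto simp: hom_def elim: pair_cat_cases)

section \<open>The projections from composable pairs\<close>

lemma is_functor_first: "is_functor (pair_cat C) (arrow_cat C) first_ftor"
proof (intro is_functor.intro is_functor_axioms.intro category_arrow_cat category_pair_cat)
  fix s t assume "s \<in> Ar (pair_cat C)" "t \<in> Ar (pair_cat C)"
    and "Cod (pair_cat C) s = Dom (pair_cat C) t"
  then show "far first_ftor (t \<cdot>\<^bsub>pair_cat C\<^esub> s) =
      far first_ftor t \<cdot>\<^bsub>arrow_cat C\<^esub> far first_ftor s"
    by (elim pair_cat_cases) (simp add: first_ftor_def)
next
  fix s assume "s \<in> Ar (pair_cat C)"
  then show "far first_ftor s \<in> hom (arrow_cat C) (fob first_ftor (Dom (pair_cat C) s))
      (fob first_ftor (Cod (pair_cat C) s))"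
    by (elim pair_cat_cases) (simp add: first_ftor_def hom_squares)
qed (auto simp: first_ftor_def)

lemma is_functor_second: "is_functor (pair_cat C) (arrow_cat C) second_ftor"
proof (intro is_functor.intro is_functor_axioms.intro category_arrow_cat category_pair_cat)
  fix s t assume "s \<in> Ar (pair_cat C)" "t \<in> Ar (pair_cat C)"
    and "Cod (pair_cat C) s = Dom (pair_cat C) t"
  then show "far second_ftor (t \<cdot>\<^bsub>pair_cat C\<^esub> s) =
      far second_ftor t \<cdot>\<^bsub>arrow_cat C\<^esub> far second_ftor s"
    by (elim pair_cat_cases) (simp add: second_ftor_def)
next
  fix s assume "s \<in> Ar (pair_cat C)"
  then show "far second_ftor s \<in> hom (arrow_cat C) (fob second_ftor (Dom (pair_cat C) s))
      (fob second_ftor (Cod (pair_cat C) s))"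
    by (elim pair_cat_cases) (simp add: second_ftor_def hom_squares)
qed (auto simp: second_ftor_def)

end

lemma is_functor_id: "category C \<Longrightarrow> is_functor C C id_ftor"
  by (intro is_functor.intro is_functor_axioms.intro)
    (auto simp: id_ftor_def hom_def category.dom_in category.cod_in)

lemma is_functor_comp:
  assumes "is_functor C D F" "is_functor D E G"
  shows "is_functor C E (G \<circ>\<^sub>F F)"
proof -
  interpret F: is_functor C D F by fact
  interpret G: is_functor D E G by fact
  show ?thesis
  proof
    fix f assume "f \<in> Ar C"
    then show "far (G \<circ>\<^sub>F F) f \<in> hom E (fob (G \<circ>\<^sub>F F) (Dom C f)) (fob (G \<circ>\<^sub>F F) (Cod C f))"
      using F.ar_in[of f] G.ar_in[of "far F f"] by (auto simp: comp_ftor_def hom_def)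
  next
    fix f g assume "f \<in> Ar C" "g \<in> Ar C" "Cod C f = Dom C g"
    then show "far (G \<circ>\<^sub>F F) (g \<cdot>\<^bsub>C\<^esub> f) = far (G \<circ>\<^sub>F F) g \<cdot>\<^bsub>E\<^esub> far (G \<circ>\<^sub>F F) f"
      using F.ar_in[of f] F.ar_in[of g]
      by (auto simp: comp_ftor_def hom_def F.preserves_comp G.preserves_comp)
  qed (auto simp: comp_ftor_def F.ob_in G.ob_in F.preserves_ident G.preserves_ident)
qed

section \<open>The factorisation and its structure maps\<close>

locale awfs_setting = orthogonal_factorisation_system C EE MM
    + awfs_construction C e_part m_part inj_l inj_r M \<iota>
  for C :: "('o, 'm) cat" (structure) and EE MM e_part m_part inj_l inj_r M \<iota> +
  assumes pushouts: "chosen_pushouts C inj_l inj_r"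
    and factorisations: "chosen_factorisations C EE MM e_part m_part"
    and idempotent: "idempotent_comonad C M \<iota>"
    and preserves: "preserves_pushouts C C M"
begin

section \<open>The idempotent comonad \<open>M\<close>\<close>

lemma M_functor: "is_functor C C M" and \<iota>_nat: "nat_trans C C M id_ftor \<iota>"
  using idempotent
  by (auto simp: idempotent_comonad_def comonad_def nat_trans_def)

lemma M_types [simp]:
  "A \<in> Ob C \<Longrightarrow> fob M A \<in> Ob C"
  "f \<in> Ar C \<Longrightarrow> far M f \<in> Ar C"
  "f \<in> Ar C \<Longrightarrow> Dom C (far M f) = fob M (Dom C f)"
  "f \<in> Ar C \<Longrightarrow> Cod C (far M f) = fob M (Cod C f)"
  using is_functor.ob_in[OF M_functor] is_functor.ar_in[OF M_functor] by (auto simp: hom_def)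

lemma M_ident [simp]: "A \<in> Ob C \<Longrightarrow> far M (Idt C A) = Idt C (fob M A)"
  using is_functor.preserves_ident[OF M_functor] .

lemma M_comp [simp]:
  "f \<in> Ar C \<Longrightarrow> g \<in> Ar C \<Longrightarrow> Cod C f = Dom C g \<Longrightarrow> far M (g \<cdot> f) = far M g \<cdot> far M f"
  using is_functor.preserves_comp[OF M_functor] .

lemma \<iota>_types [simp]:
  assumes "A \<in> Ob C"
  shows "\<iota> A \<in> Ar C" "Dom C (\<iota> A) = fob M A" "Cod C (\<iota> A) = A"
  using nat_trans.component_in[OF \<iota>_nat assms] by (auto simp: hom_def id_ftor_def)

lemma \<iota>_natural: "f \<in> Ar C \<Longrightarrow> \<iota> (Cod C f) \<cdot> far M f = f \<cdot> \<iota> (Dom C f)"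
  using nat_trans.naturality[OF \<iota>_nat] by (simp add: id_ftor_def)

text \<open>By the two counit laws, \<open>\<iota> (fob M A)\<close> and
  \<open>far M (\<iota> A)\<close> are both left inverses of the comultiplication at
  \<open>A\<close>. As the latter is invertible, both are its inverse, hence equal and
  invertible.\<close>

lemma M_\<iota>_iso: "A \<in> Ob C \<Longrightarrow> iso_arrow C (far M (\<iota> A))"
  and \<iota>_M: "A \<in> Ob C \<Longrightarrow> \<iota> (fob M A) = far M (\<iota> A)"
proof -
  assume A: "A \<in> Ob C"
  obtain d where "comonad C M \<iota> d" and iso: "iso_arrow C (d A)"
    using idempotent A by (auto simp: idempotent_comonad_def)
  then interpret comonad C M \<iota> d by simp
  have ty [simp]: "d A \<in> Ar C" "Dom C (d A) = fob M A" "Cod C (d A) = fob M (fob M A)"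
    using comult.component_in[OF A] by (auto simp: hom_def comp_ftor_def)
  show eq: "\<iota> (fob M A) = far M (\<iota> A)"
    by (rule iso_arrow_epi[OF iso]) (use A counit_left[OF A] counit_right[OF A] in simp_all)
  obtain e where e: "inverse_arrows C (d A) e" using iso by (auto simp: iso_arrow_def)
  have "far M (\<iota> A) = e"
    by (rule iso_arrow_epi[OF iso])
      (use A counit_right[OF A] e in \<open>simp_all add: inverse_arrows_def hom_def\<close>)
  then show "iso_arrow C (far M (\<iota> A))"
    using e A unfolding iso_arrow_def inverse_arrows_def hom_def by (intro exI[of _ "d A"]) auto
qed

section \<open>Factorisations, pushouts and the maps they induce\<close>

lemma S_types [simp]:
  assumes "f \<in> Ar C"
  shows "S f \<in> EE" "S f \<in> Ar C" "Dom C (S f) = fob M (Dom C f)" "Cod C (S f) = J_ob f"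
    and T_types: "T f \<in> MM" "T f \<in> Ar C" "Dom C (T f) = J_ob f" "Cod C (T f) = Cod C f"
    and T_S: "T f \<cdot> S f = f \<cdot> \<iota> (Dom C f)"
    and J_ob_in: "J_ob f \<in> Ob C"
proof -
  let ?p = "f \<cdot> \<iota> (Dom C f)"
  have p: "?p \<in> Ar C" "Dom C ?p = fob M (Dom C f)" "Cod C ?p = Cod C f" using assms by simp_all
  have fac: "e_part ?p \<in> EE" "m_part ?p \<in> MM" "Cod C (e_part ?p) = Dom C (m_part ?p)"
    "m_part ?p \<cdot> e_part ?p = ?p"
    using factorisations p(1) by (auto simp: chosen_factorisations_def)
  then have ar: "e_part ?p \<in> Ar C" "m_part ?p \<in> Ar C" using EE_sub MM_sub by auto
  note ar comp_types[OF ar fac(3)]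
  then show "S f \<in> EE" "S f \<in> Ar C" "Dom C (S f) = fob M (Dom C f)" "Cod C (S f) = J_ob f"
    "T f \<in> MM" "T f \<in> Ar C" "Dom C (T f) = J_ob f" "Cod C (T f) = Cod C f"
    "T f \<cdot> S f = f \<cdot> \<iota> (Dom C f)"
    using p fac by (auto simp: S_def T_def J_ob_def)
  then show "J_ob f \<in> Ob C" using dom_in by metis
qed

lemma L_types [simp]:
  assumes "f \<in> Ar C"
  shows "L f \<in> Ar C" "Dom C (L f) = Dom C f" "Cod C (L f) = E_ob f"
    and alpha_types: "alpha f \<in> Ar C" "Dom C (alpha f) = J_ob f" "Cod C (alpha f) = E_ob f"
    and alpha_S: "alpha f \<cdot> S f = L f \<cdot> \<iota> (Dom C f)"
    and E_ob_in: "E_ob f \<in> Ob C"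
    and E_pushout: "is_pushout C (\<iota> (Dom C f)) (S f) (L f) (alpha f)"
proof -
  show po: "is_pushout C (\<iota> (Dom C f)) (S f) (L f) (alpha f)"
    using pushouts assms by (simp add: chosen_pushouts_def L_def alpha_def)
  then show "L f \<in> Ar C" "Dom C (L f) = Dom C f" "Cod C (L f) = E_ob f"
    "alpha f \<in> Ar C" "Dom C (alpha f) = J_ob f" "Cod C (alpha f) = E_ob f"
    "alpha f \<cdot> S f = L f \<cdot> \<iota> (Dom C f)"
    using assms by (auto simp: is_pushout_def E_ob_def)
  then show "E_ob f \<in> Ob C" using cod_in by metis
qed

text \<open>This is the diagonal filler of \<open>S f\<close> against \<open>m\<close>. Its
  existence, for \<open>m\<close> of the form \<open>T g\<close>, supplies the maps out of
  \<open>J_ob f\<close>; its uniqueness is \<open>J_eqI\<close>.\<close>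

lemma J_ex1:
  assumes "f \<in> Ar C" "m \<in> MM" "u \<in> Ar C" "v \<in> Ar C"
    and "Dom C u = fob M (Dom C f)" "Cod C u = Dom C m" "Dom C v = J_ob f" "Cod C v = Cod C m"
    and "m \<cdot> u = v \<cdot> S f"
  shows "\<exists>!w. w \<in> hom C (J_ob f) (Dom C m) \<and> w \<cdot> S f = u \<and> m \<cdot> w = v"
  using orthogonality[of "S f" m u v] assms by (simp add: hom_def)

lemma J_eqI:
  assumes "f \<in> Ar C" "m \<in> MM" "u \<in> Ar C" "v \<in> Ar C"
    and "Dom C u = J_ob f" "Dom C v = J_ob f" "Cod C u = Dom C m" "Cod C v = Dom C m"
    and "u \<cdot> S f = v \<cdot> S f" "m \<cdot> u = m \<cdot> v"
  shows "u = v"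
proof -
  have "m \<in> Ar C" using assms(2) MM_sub by auto
  then have "\<exists>!w. w \<in> hom C (J_ob f) (Dom C m) \<and> w \<cdot> S f = v \<cdot> S f \<and> m \<cdot> w = m \<cdot> v"
    using assms by (intro J_ex1) auto
  then show ?thesis using assms by (auto simp: hom_def)
qed

lemma E_ex1:
  assumes "f \<in> Ar C" "u \<in> Ar C" "v \<in> Ar C"
    and "Dom C u = Dom C f" "Dom C v = J_ob f" "Cod C v = X" "Cod C u = X"
    and "u \<cdot> \<iota> (Dom C f) = v \<cdot> S f"
  shows "\<exists>!w. w \<in> hom C (E_ob f) X \<and> w \<cdot> L f = u \<and> w \<cdot> alpha f = v"
  using pushout_ex1[OF E_pushout[OF assms(1)] assms(2,3)] assms by simp

lemma E_eqI:
  assumes "f \<in> Ar C" "u \<in> Ar C" "v \<in> Ar C"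
    and "Dom C u = E_ob f" "Dom C v = E_ob f" "Cod C u = Cod C v"
    and "u \<cdot> L f = v \<cdot> L f" "u \<cdot> alpha f = v \<cdot> alpha f"
  shows "u = v"
proof -
  have "\<exists>!w. w \<in> hom C (E_ob f) (Cod C v) \<and> w \<cdot> L f = v \<cdot> L f \<and> w \<cdot> alpha f = v \<cdot> alpha f"
    using assms by (intro E_ex1) auto
  then show ?thesis using assms by (auto simp: hom_def)
qed

lemma J_types [simp]:
  assumes "Sq f h k g \<in> Ar (arrow_cat C)"
  shows "J_ar (Sq f h k g) \<in> Ar C" "Dom C (J_ar (Sq f h k g)) = J_ob f"
    "Cod C (J_ar (Sq f h k g)) = J_ob g"
    and J_S: "J_ar (Sq f h k g) \<cdot> S f = S g \<cdot> far M h"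
    and T_J: "T g \<cdot> J_ar (Sq f h k g) = k \<cdot> T f"
proof -
  have s: "f \<in> Ar C" "g \<in> Ar C" "h \<in> Ar C" "k \<in> Ar C" "Dom C h = Dom C f" "Cod C h = Dom C g"
    "Dom C k = Cod C f" "Cod C k = Cod C g" and eq: "k \<cdot> f = g \<cdot> h"
    using assms by simp_all
  \<comment> \<open>The square to be filled commutes: naturality of \<open>\<iota>\<close> at
    \<open>h\<close> turns \<open>far M h\<close> into \<open>h\<close>, after which the given
    square applies.\<close>
  have "T g \<cdot> (S g \<cdot> far M h) = g \<cdot> (h \<cdot> \<iota> (Dom C f))"
    using s \<iota>_natural[of h] by (simp add: comp_reassoc[OF T_S])
  also have "\<dots> = (k \<cdot> T f) \<cdot> S f"
    using s by (simp add: comp_reassoc[OF eq])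
  finally have "\<exists>!w. w \<in> hom C (J_ob f) (J_ob g) \<and> w \<cdot> S f = S g \<cdot> far M h \<and> T g \<cdot> w = k \<cdot> T f"
    using s J_ex1[of f "T g" "S g \<cdot> far M h" "k \<cdot> T f"] by (simp del: comp_assoc)
  then have "J_ar (Sq f h k g) \<in> hom C (J_ob f) (J_ob g) \<and>
      J_ar (Sq f h k g) \<cdot> S f = S g \<cdot> far M h \<and> T g \<cdot> J_ar (Sq f h k g) = k \<cdot> T f"
    unfolding J_ar_def sq.sel by (rule theI')
  then show "J_ar (Sq f h k g) \<in> Ar C" "Dom C (J_ar (Sq f h k g)) = J_ob f"
    "Cod C (J_ar (Sq f h k g)) = J_ob g"
    "J_ar (Sq f h k g) \<cdot> S f = S g \<cdot> far M h" "T g \<cdot> J_ar (Sq f h k g) = k \<cdot> T f"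
    by (auto simp: hom_def)
qed

lemma nu_types [simp]:
  assumes "f \<in> Ar C"
  shows "nu f \<in> Ar C" "Dom C (nu f) = J_ob (T f)" "Cod C (nu f) = J_ob f"
    and nu_S: "nu f \<cdot> S (T f) = \<iota> (J_ob f)"
    and T_nu: "T f \<cdot> nu f = T (T f)"
proof -
  have "\<exists>!w. w \<in> hom C (J_ob (T f)) (J_ob f) \<and> w \<cdot> S (T f) = \<iota> (J_ob f) \<and> T f \<cdot> w = T (T f)"
    using assms J_ex1[of "T f" "T f" "\<iota> (J_ob f)" "T (T f)"] by simp
  then have "nu f \<in> hom C (J_ob (T f)) (J_ob f) \<and> nu f \<cdot> S (T f) = \<iota> (J_ob f) \<and> T f \<cdot> nu f = T (T f)"
    unfolding nu_def by (rule theI')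
  then show "nu f \<in> Ar C" "Dom C (nu f) = J_ob (T f)" "Cod C (nu f) = J_ob f"
    "nu f \<cdot> S (T f) = \<iota> (J_ob f)" "T f \<cdot> nu f = T (T f)"
    by (auto simp: hom_def)
qed

lemma R_types [simp]:
  assumes "f \<in> Ar C"
  shows "R f \<in> Ar C" "Dom C (R f) = E_ob f" "Cod C (R f) = Cod C f"
    and R_L: "R f \<cdot> L f = f" and R_alpha: "R f \<cdot> alpha f = T f"
proof -
  have "\<exists>!w. w \<in> hom C (E_ob f) (Cod C f) \<and> w \<cdot> L f = f \<and> w \<cdot> alpha f = T f"
    using assms by (intro E_ex1) simp_all
  then have "R f \<in> hom C (E_ob f) (Cod C f) \<and> R f \<cdot> L f = f \<and> R f \<cdot> alpha f = T f"
    unfolding R_def by (rule theI')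
  then show "R f \<in> Ar C" "Dom C (R f) = E_ob f" "Cod C (R f) = Cod C f"
    "R f \<cdot> L f = f" "R f \<cdot> alpha f = T f"
    by (auto simp: hom_def)
qed

lemma E_types [simp]:
  assumes "Sq f h k g \<in> Ar (arrow_cat C)"
  shows "E_ar (Sq f h k g) \<in> Ar C" "Dom C (E_ar (Sq f h k g)) = E_ob f"
    "Cod C (E_ar (Sq f h k g)) = E_ob g"
    and E_L: "E_ar (Sq f h k g) \<cdot> L f = L g \<cdot> h"
    and E_alpha: "E_ar (Sq f h k g) \<cdot> alpha f = alpha g \<cdot> J_ar (Sq f h k g)"
proof -
  have s: "f \<in> Ar C" "g \<in> Ar C" "h \<in> Ar C" "k \<in> Ar C" "Dom C h = Dom C f" "Cod C h = Dom C g"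
    "Dom C k = Cod C f" "Cod C k = Cod C g"
    using assms by simp_all
  note J [simp] = J_types(1-3)[OF assms]
  \<comment> \<open>Compatibility over the span: both sides equal
    \<open>L g \<cdot> \<iota> (Dom C g) \<cdot> far M h\<close>, by \<open>J_S\<close> and
    \<open>alpha_S\<close> on the left and by naturality of \<open>\<iota>\<close> on the
    right.\<close>
  have "(alpha g \<cdot> J_ar (Sq f h k g)) \<cdot> S f = (L g \<cdot> h) \<cdot> \<iota> (Dom C f)"
    using s \<iota>_natural[of h]
    by (simp add: J_S[OF assms] comp_reassoc[OF alpha_S] del: J_types square_iff)
  then have "\<exists>!w. w \<in> hom C (E_ob f) (E_ob g) \<and> w \<cdot> L f = L g \<cdot> h \<and>
      w \<cdot> alpha f = alpha g \<cdot> J_ar (Sq f h k g)"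
    using s E_ex1[of f "L g \<cdot> h" "alpha g \<cdot> J_ar (Sq f h k g)" "E_ob g"]
    by (simp del: comp_assoc J_types square_iff)
  then have "E_ar (Sq f h k g) \<in> hom C (E_ob f) (E_ob g) \<and> E_ar (Sq f h k g) \<cdot> L f = L g \<cdot> h \<and>
      E_ar (Sq f h k g) \<cdot> alpha f = alpha g \<cdot> J_ar (Sq f h k g)"
    unfolding E_ar_def sq.sel by (rule theI')
  then show "E_ar (Sq f h k g) \<in> Ar C" "Dom C (E_ar (Sq f h k g)) = E_ob f"
    "Cod C (E_ar (Sq f h k g)) = E_ob g"
    "E_ar (Sq f h k g) \<cdot> L f = L g \<cdot> h"
    "E_ar (Sq f h k g) \<cdot> alpha f = alpha g \<cdot> J_ar (Sq f h k g)"
    by (auto simp: hom_def)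
qed

lemmas factorisation_reassoc [simp] =
  T_S[THEN comp_reassoc] alpha_S[THEN comp_reassoc] J_S[THEN comp_reassoc] T_J[THEN comp_reassoc]
  R_L[THEN comp_reassoc] R_alpha[THEN comp_reassoc] E_L[THEN comp_reassoc] E_alpha[THEN comp_reassoc]

text \<open>Since \<open>M_comp\<close> splits the image of a composite, an equation carried through
  \<open>M\<close> has to be available with its left side already split.\<close>

lemma M_eq: "g \<cdot> f = k \<Longrightarrow> g \<in> Ar C \<Longrightarrow> f \<in> Ar C \<Longrightarrow> Cod C f = Dom C g \<Longrightarrow> far M g \<cdot> far M f = far M k"
  by auto

lemma R_E [simp]:
  assumes "Sq f h k g \<in> Ar (arrow_cat C)"
  shows "R g \<cdot> E_ar (Sq f h k g) = k \<cdot> R f"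
proof (rule E_eqI[of f])
  show "(R g \<cdot> E_ar (Sq f h k g)) \<cdot> L f = (k \<cdot> R f) \<cdot> L f"
    using assms by simp
qed (use assms in simp_all)

section \<open>Invertibility results and the map \<open>kappa\<close>\<close>

text \<open>With an identity below, \<open>f = g \<cdot> h\<close>, so the inverse of
  \<open>far M h\<close> turns the factorisation of \<open>f \<cdot> \<iota> (Dom C f)\<close> into
  one of \<open>g \<cdot> \<iota> (Dom C g)\<close> through \<open>T f\<close>. Filling
  \<open>S g\<close> against \<open>T f\<close> then produces the inverse.\<close>

lemma J_iso:
  assumes sq: "Sq f h (Idt C B) g \<in> Ar (arrow_cat C)" and B: "B \<in> Ob C"
    and iso: "iso_arrow C (far M h)"
  shows "iso_arrow C (J_ar (Sq f h (Idt C B) g))"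
proof -
  let ?J = "J_ar (Sq f h (Idt C B) g)"
  define i where "i = inverse_arrow C (far M h)"
  have h: "f \<in> Ar C" "g \<in> Ar C" "h \<in> Ar C" "Dom C h = Dom C f" "Cod C h = Dom C g"
    "Cod C f = B" "Cod C g = B" and f: "f = g \<cdot> h"
    using sq B by auto
  have i [simp]: "i \<in> Ar C" "Dom C i = fob M (Dom C g)" "Cod C i = fob M (Dom C f)"
    "i \<cdot> far M h = Idt C (fob M (Dom C f))" "far M h \<cdot> i = Idt C (fob M (Dom C g))"
    using inverse_arrow_types[OF iso] h by (simp_all add: i_def)
  note Jt [simp] = J_types[OF sq]
  \<comment> \<open>Writing \<open>f\<close> as \<open>g \<cdot> h\<close> and using naturality of
    \<open>\<iota>\<close> at \<open>h\<close> brings \<open>far M h\<close> next to its inverse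
    \<open>i\<close>.\<close>
  have "f \<cdot> (\<iota> (Dom C f) \<cdot> i) = g \<cdot> ((h \<cdot> \<iota> (Dom C h)) \<cdot> i)"
    using h by (subst f) simp
  also have "\<dots> = g \<cdot> (\<iota> (Dom C g) \<cdot> (far M h \<cdot> i))"
    using h by (subst \<iota>_natural[symmetric]) simp_all
  also have "\<dots> = T g \<cdot> S g" using h by (simp del: M_types)
  finally have "T f \<cdot> (S f \<cdot> i) = T g \<cdot> S g"
    using h by (simp add: comp_reassoc[OF T_S] del: square_iff)
  then obtain w where w: "w \<in> hom C (J_ob g) (J_ob f)"
    and wS: "w \<cdot> S g = S f \<cdot> i" and wT: "T f \<cdot> w = T g"
    using J_ex1[of g "T f" "S f \<cdot> i" "T g"] h by auto
  have w [simp]: "w \<in> Ar C" "Dom C w = J_ob g" "Cod C w = J_ob f"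
    using w by (auto simp: hom_def)
  have "w \<cdot> ?J = Idt C (J_ob f)"
    by (rule J_eqI[of f "T f"])
      (use h in \<open>simp_all add: wT comp_reassoc[OF wS] comp_reassoc[OF wT] del: square_iff\<close>)
  moreover have "?J \<cdot> w = Idt C (J_ob g)"
    by (rule J_eqI[of g "T g"])
      (use h in \<open>simp_all add: wS wT comp_reassoc[OF J_S[OF sq]] comp_reassoc[OF T_J[OF sq]] del: square_iff\<close>)
  ultimately have "inverse_arrows C ?J w"
    by (simp add: inverse_arrows_def hom_def del: square_iff)
  then show ?thesis
    unfolding iso_arrow_def by blast
qed

lemma M_alpha_iso:
  assumes "f \<in> Ar C"
  shows "iso_arrow C (far M (alpha f))"
proof (rule pushout_of_iso)
  show "is_pushout C (far M (\<iota> (Dom C f))) (far M (S f)) (far M (L f)) (far M (alpha f))"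
    using preserves E_pushout[OF assms] unfolding preserves_pushouts_def by simp
  show "iso_arrow C (far M (\<iota> (Dom C f)))"
    using assms by (intro M_\<iota>_iso) simp
qed

definition kappa :: "'m \<Rightarrow> 'm" where
  "kappa f = nu f \<cdot> inverse_arrow C (J_ar (Sq (T f) (alpha f) (Idt C (Cod C f)) (R f)))"

text \<open>The conjuncts \<open>kappa_S\<close> and \<open>T_kappa\<close> determine \<open>kappa f\<close>, by \<open>JR_eqI\<close> below; no other property
  of \<open>nu\<close> or of the inverse is needed.\<close>

lemma kappa_types [simp]:
  assumes "f \<in> Ar C"
  shows "kappa f \<in> Ar C" "Dom C (kappa f) = J_ob (R f)" "Cod C (kappa f) = J_ob f"
    and kappa_S: "kappa f \<cdot> (S (R f) \<cdot> far M (alpha f)) = \<iota> (J_ob f)"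
    and T_kappa: "T f \<cdot> kappa f = T (R f)"
proof -
  let ?J = "J_ar (Sq (T f) (alpha f) (Idt C (Cod C f)) (R f))"
  define j where "j = inverse_arrow C ?J"
  have sq: "Sq (T f) (alpha f) (Idt C (Cod C f)) (R f) \<in> Ar (arrow_cat C)"
    using assms by simp
  note Jt [simp] = J_types[OF sq]
  have iso: "iso_arrow C ?J"
    using assms by (intro J_iso sq M_alpha_iso) simp_all
  have j [simp]: "j \<in> Ar C" "Dom C j = J_ob (R f)" "Cod C j = J_ob (T f)"
    "j \<cdot> ?J = Idt C (J_ob (T f))" "?J \<cdot> j = Idt C (J_ob (R f))"
    using inverse_arrow_types[OF iso] by (simp_all add: j_def del: square_iff)
  have k: "kappa f = nu f \<cdot> j" by (simp add: kappa_def j_def)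
  show "kappa f \<in> Ar C" "Dom C (kappa f) = J_ob (R f)" "Cod C (kappa f) = J_ob f"
    using assms by (simp_all add: k)
  \<comment> \<open>By \<open>J_S\<close>, \<open>S (R f) \<cdot> far M (alpha f)\<close> is
    \<open>?J \<cdot> S (T f)\<close>; then \<open>j\<close> cancels \<open>?J\<close> and
    \<open>nu_S\<close> remains.\<close>
  have "kappa f \<cdot> (S (R f) \<cdot> far M (alpha f)) = nu f \<cdot> (j \<cdot> (?J \<cdot> S (T f)))"
    using assms by (simp add: k)
  also have "\<dots> = nu f \<cdot> ((j \<cdot> ?J) \<cdot> S (T f))"
    using assms by (simp del: j(4))
  finally show "kappa f \<cdot> (S (R f) \<cdot> far M (alpha f)) = \<iota> (J_ob f)"
    using assms by simp
  \<comment> \<open>\<open>T_nu\<close> produces \<open>T (T f)\<close>, which is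
    \<open>T (R f) \<cdot> ?J\<close> by \<open>T_J\<close> because the lower side of the square is
    an identity.\<close>
  have "T f \<cdot> kappa f = (T (R f) \<cdot> ?J) \<cdot> j"
    using assms by (simp add: k comp_reassoc[OF T_nu])
  also have "\<dots> = T (R f) \<cdot> (?J \<cdot> j)"
    using assms by (intro comp_assoc) simp_all
  finally show "T f \<cdot> kappa f = T (R f)"
    using assms by simp
qed

lemma JR_eqI:
  assumes "f \<in> Ar C" "m \<in> MM" "u \<in> Ar C" "v \<in> Ar C"
    and "Dom C u = J_ob (R f)" "Dom C v = J_ob (R f)" "Cod C u = Dom C m" "Cod C v = Dom C m"
    and "u \<cdot> (S (R f) \<cdot> far M (alpha f)) = v \<cdot> (S (R f) \<cdot> far M (alpha f))" "m \<cdot> u = m \<cdot> v"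
  shows "u = v"
proof (rule J_eqI[of "R f" m])
  show "u \<cdot> S (R f) = v \<cdot> S (R f)"
    by (rule iso_arrow_epi[OF M_alpha_iso[of f]]) (use assms in simp_all)
qed (use assms in simp_all)

text \<open>The left side of \<open>kappa_S\<close> has three factors, so
  \<open>comp_reassoc\<close> alone leaves an inner bracket to be normalised.\<close>

lemma kappa_S_reassoc [simp]:
  assumes "f \<in> Ar C" "x \<in> Ar C" "Cod C x = fob M (J_ob f)"
  shows "kappa f \<cdot> (S (R f) \<cdot> (far M (alpha f) \<cdot> x)) = \<iota> (J_ob f) \<cdot> x"
  using comp_reassoc[OF kappa_S[OF assms(1)]] assms by simp

lemma mu_types [simp]:
  assumes "f \<in> Ar C"
  shows "mu_ar f \<in> Ar C" "Dom C (mu_ar f) = E_ob (R f)" "Cod C (mu_ar f) = E_ob f"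
    and mu_L: "mu_ar f \<cdot> L (R f) = Idt C (E_ob f)"
    and mu_alpha: "mu_ar f \<cdot> alpha (R f) = alpha f \<cdot> kappa f"
proof -
  \<comment> \<open>This is the condition for inducing \<open>mu_ar f\<close> out of the pushout.
    Precomposed with the invertible \<open>far M (alpha f)\<close>, both sides become
    \<open>alpha f \<cdot> \<iota> (J_ob f)\<close>, by naturality of \<open>\<iota>\<close> and by
    \<open>kappa_S\<close>.\<close>
  have "\<iota> (E_ob f) = (alpha f \<cdot> kappa f) \<cdot> S (R f)"
    by (rule iso_arrow_epi[OF M_alpha_iso[OF assms]])
      (use assms \<iota>_natural[of "alpha f"] in simp_all)
  then have "\<exists>!w. w \<in> hom C (E_ob (R f)) (E_ob f) \<and> w \<cdot> L (R f) = Idt C (E_ob f) \<and>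
      w \<cdot> alpha (R f) = alpha f \<cdot> kappa f"
    using assms by (intro E_ex1) simp_all
  then have "mu_ar f \<in> hom C (E_ob (R f)) (E_ob f) \<and> mu_ar f \<cdot> L (R f) = Idt C (E_ob f) \<and>
      mu_ar f \<cdot> alpha (R f) = alpha f \<cdot> kappa f"
    \<comment> \<open>Composition associates to the right, so the term prescribed in
      \<open>mu_ar_def\<close> is literally \<open>alpha f \<cdot> kappa f\<close>.\<close>
    unfolding mu_ar_def kappa_def by (rule theI')
  then show "mu_ar f \<in> Ar C" "Dom C (mu_ar f) = E_ob (R f)" "Cod C (mu_ar f) = E_ob f"
    "mu_ar f \<cdot> L (R f) = Idt C (E_ob f)" "mu_ar f \<cdot> alpha (R f) = alpha f \<cdot> kappa f"
    by (auto simp: hom_def)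
qed

text \<open>The square to be filled commutes because \<open>T (L f) \<cdot> S (L f)\<close> and
  \<open>alpha f \<cdot> S f\<close> are both \<open>L f \<cdot> \<iota> (Dom C f)\<close>, the
  first by factorisation and the second by the pushout.\<close>

lemma delta_types [simp]:
  assumes "f \<in> Ar C"
  shows "delta f \<in> Ar C" "Dom C (delta f) = J_ob f" "Cod C (delta f) = J_ob (L f)"
    and delta_S: "delta f \<cdot> S f = S (L f)" and T_delta: "T (L f) \<cdot> delta f = alpha f"
proof -
  have "\<exists>!w. w \<in> hom C (J_ob f) (J_ob (L f)) \<and> w \<cdot> S f = S (L f) \<and> T (L f) \<cdot> w = alpha f"
    using assms J_ex1[of f "T (L f)" "S (L f)" "alpha f"] by simp
  then have "delta f \<in> hom C (J_ob f) (J_ob (L f)) \<and> delta f \<cdot> S f = S (L f) \<and>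
      T (L f) \<cdot> delta f = alpha f"
    unfolding delta_def by (rule theI')
  then show "delta f \<in> Ar C" "Dom C (delta f) = J_ob f" "Cod C (delta f) = J_ob (L f)"
    "delta f \<cdot> S f = S (L f)" "T (L f) \<cdot> delta f = alpha f"
    by (auto simp: hom_def)
qed

lemma Delta_types [simp]:
  assumes "f \<in> Ar C"
  shows "Delta_ar f \<in> Ar C" "Dom C (Delta_ar f) = E_ob f" "Cod C (Delta_ar f) = E_ob (L f)"
    and Delta_L: "Delta_ar f \<cdot> L f = L (L f)"
    and Delta_alpha: "Delta_ar f \<cdot> alpha f = alpha (L f) \<cdot> delta f"
proof -
  have "\<exists>!w. w \<in> hom C (E_ob f) (E_ob (L f)) \<and> w \<cdot> L f = L (L f) \<and>
      w \<cdot> alpha f = alpha (L f) \<cdot> delta f"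
    using assms by (intro E_ex1) simp_all
  then have "Delta_ar f \<in> hom C (E_ob f) (E_ob (L f)) \<and> Delta_ar f \<cdot> L f = L (L f) \<and>
      Delta_ar f \<cdot> alpha f = alpha (L f) \<cdot> delta f"
    unfolding Delta_ar_def by (rule theI')
  then show "Delta_ar f \<in> Ar C" "Dom C (Delta_ar f) = E_ob f" "Cod C (Delta_ar f) = E_ob (L f)"
    "Delta_ar f \<cdot> L f = L (L f)" "Delta_ar f \<cdot> alpha f = alpha (L f) \<cdot> delta f"
    by (auto simp: hom_def)
qed

lemmas structure_reassoc [simp] =
  T_kappa[THEN comp_reassoc] mu_L[THEN comp_reassoc] mu_alpha[THEN comp_reassoc]
  delta_S[THEN comp_reassoc] T_delta[THEN comp_reassoc] Delta_L[THEN comp_reassoc]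
  Delta_alpha[THEN comp_reassoc] R_E[THEN comp_reassoc]

section \<open>The laws\<close>

text \<open>Makes \<open>mu f\<close> a square with an identity below, and is the lower side of
  \<open>law_counit\<close>.\<close>

lemma R_mu [simp]:
  assumes "f \<in> Ar C"
  shows "R f \<cdot> mu_ar f = R (R f)"
  by (rule E_eqI[of "R f"]) (use assms in simp_all)

text \<open>Gives one counit law of \<open>Delta\<close>. With \<open>mu_L\<close> it also makes the
  component of the distributive law a commuting square, both of whose composites are
  identities.\<close>

lemma R_Delta [simp]:
  assumes "f \<in> Ar C"
  shows "R (L f) \<cdot> Delta_ar f = Idt C (E_ob f)"
  by (rule E_eqI[of f]) (use assms in simp_all)

lemmas reassoc_R [simp] = R_mu[THEN comp_reassoc] R_Delta[THEN comp_reassoc]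

section \<open>Functoriality of \<open>J_ar\<close> and \<open>E_ar\<close>\<close>

lemma J_ident:
  assumes "f \<in> Ar C"
  shows "J_ar (Sq f (Idt C (Dom C f)) (Idt C (Cod C f)) f) = Idt C (J_ob f)"
  by (rule J_eqI[of f "T f"]) (use assms in simp_all)

lemma J_comp:
  assumes "Sq f h k g \<in> Ar (arrow_cat C)" "Sq g h' k' g' \<in> Ar (arrow_cat C)"
  shows "J_ar (Sq f (h' \<cdot> h) (k' \<cdot> k) g') = J_ar (Sq g h' k' g') \<cdot> J_ar (Sq f h k g)"
proof -
  have sq: "Sq f (h' \<cdot> h) (k' \<cdot> k) g' \<in> Ar (arrow_cat C)"
    using assms comp_paste[of k f g h k' g' h'] by (simp del: comp_assoc)
  note [simp] = J_types[OF sq] J_types[OF assms(1)] J_types[OF assms(2)]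
    comp_reassoc[OF J_S[OF assms(2)]] comp_reassoc[OF T_J[OF assms(2)]]
  show ?thesis
    by (rule J_eqI[of f "T g'"]) (use assms in simp_all)
qed

lemma E_ident:
  assumes "f \<in> Ar C"
  shows "E_ar (Sq f (Idt C (Dom C f)) (Idt C (Cod C f)) f) = Idt C (E_ob f)"
  by (rule E_eqI[of f]) (use assms in \<open>simp_all add: J_ident\<close>)

lemma E_comp:
  assumes "Sq f h k g \<in> Ar (arrow_cat C)" "Sq g h' k' g' \<in> Ar (arrow_cat C)"
  shows "E_ar (Sq f (h' \<cdot> h) (k' \<cdot> k) g') = E_ar (Sq g h' k' g') \<cdot> E_ar (Sq f h k g)"
proof -
  have sq: "Sq f (h' \<cdot> h) (k' \<cdot> k) g' \<in> Ar (arrow_cat C)"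
    using assms comp_paste[of k f g h k' g' h'] by (simp del: comp_assoc)
  note [simp] = E_types[OF sq] E_types[OF assms(1)] E_types[OF assms(2)]
    J_types[OF assms(1)] J_types[OF assms(2)]
    comp_reassoc[OF E_L[OF assms(2)]] comp_reassoc[OF E_alpha[OF assms(2)]]
  show ?thesis
    by (rule E_eqI[of f]) (use assms in \<open>simp_all add: J_comp[OF assms]\<close>)
qed

section \<open>The laws of the multiplication\<close>

text \<open>In \<open>JR_eqI\<close>, \<open>E_alpha\<close> under \<open>M\<close> moves
  \<open>far M (alpha f)\<close> past the image of \<open>E_ar\<close>, and both sides become
  \<open>J_ar (Sq f h k g) \<cdot> \<iota> (J_ob f)\<close>. Against \<open>T g\<close> both become
  \<open>k \<cdot> T (R f)\<close>.\<close>

lemma kappa_natural: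
  assumes sq: "Sq f h k g \<in> Ar (arrow_cat C)"
  shows "kappa g \<cdot> J_ar (Sq (R f) (E_ar (Sq f h k g)) k (R g)) = J_ar (Sq f h k g) \<cdot> kappa f"
    (is "kappa g \<cdot> ?JR = ?J \<cdot> kappa f")
proof -
  let ?E = "E_ar (Sq f h k g)"
  have f: "f \<in> Ar C" "g \<in> Ar C" "h \<in> Ar C" "k \<in> Ar C" "Dom C k = Cod C f" "Cod C k = Cod C g"
    using sq by simp_all
  have sqR: "Sq (R f) ?E k (R g) \<in> Ar (arrow_cat C)"
    using sq by simp
  note [simp] = J_types[OF sq] E_types[OF sq] J_types[OF sqR]
    comp_reassoc[OF J_S[OF sqR]] comp_reassoc[OF T_J[OF sq]]
  show ?thesis
  proof (rule JR_eqI[of f "T g"])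
    show "(kappa g \<cdot> ?JR) \<cdot> (S (R f) \<cdot> far M (alpha f)) =
        (?J \<cdot> kappa f) \<cdot> (S (R f) \<cdot> far M (alpha f))"
      using f \<iota>_natural[of ?J] by (simp add: M_eq[OF E_alpha[OF sq]] del: square_iff)
  qed (use f in \<open>simp_all del: square_iff\<close>)
qed

lemma mu_natural:
  assumes sq: "Sq f h k g \<in> Ar (arrow_cat C)"
  shows "mu_ar g \<cdot> E_ar (Sq (R f) (E_ar (Sq f h k g)) k (R g)) = E_ar (Sq f h k g) \<cdot> mu_ar f"
    (is "mu_ar g \<cdot> ?ER = ?E \<cdot> mu_ar f")
proof -
  have f: "f \<in> Ar C" "g \<in> Ar C"
    using sq by simp_all
  have sqR: "Sq (R f) ?E k (R g) \<in> Ar (arrow_cat C)"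
    using sq by simp
  note [simp] = J_types[OF sq] E_types[OF sq] J_types[OF sqR] E_types[OF sqR] kappa_natural[OF sq]
    comp_reassoc[OF E_alpha[OF sq]]
  show ?thesis
    by (rule E_eqI[of "R f"]) (use f in \<open>simp_all del: square_iff\<close>)
qed

text \<open>\<open>kappa_S\<close> concerns \<open>far M (alpha f)\<close>, whereas
  \<open>far M (L f)\<close> occurs here. Precomposing with the invertible
  \<open>far M (\<iota> (Dom C f))\<close> exchanges them through the pushout square. Naturality of
  \<open>\<iota>\<close> at \<open>S f\<close> then suffices, by the identification
  \<open>\<iota>_M\<close>.\<close>

lemma kappa_unit:
  assumes "f \<in> Ar C"
  shows "kappa f \<cdot> J_ar (Sq f (L f) (Idt C (Cod C f)) (R f)) = Idt C (J_ob f)"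
proof (rule J_eqI[of f "T f"])
  have "far M (L f) \<cdot> far M (\<iota> (Dom C f)) = far M (alpha f) \<cdot> far M (S f)"
    using assms M_eq[OF alpha_S] by simp
  then have "(kappa f \<cdot> (S (R f) \<cdot> far M (L f))) \<cdot> far M (\<iota> (Dom C f)) = S f \<cdot> far M (\<iota> (Dom C f))"
    using assms \<iota>_natural[of "S f"] by (simp add: \<iota>_M)
  then have "kappa f \<cdot> (S (R f) \<cdot> far M (L f)) = S f"
    by (rule iso_arrow_epi[OF M_\<iota>_iso, rotated -1]) (use assms in simp_all)
  then show "(kappa f \<cdot> J_ar (Sq f (L f) (Idt C (Cod C f)) (R f))) \<cdot> S f = Idt C (J_ob f) \<cdot> S f"
    using assms by simp
qed (use assms in simp_all)

text \<open>This is the unit law involving the image of the unit under \<open>R\<close>; the other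
  one is \<open>mu_L\<close>.\<close>

lemma mu_unit:
  assumes "f \<in> Ar C"
  shows "mu_ar f \<cdot> E_ar (Sq f (L f) (Idt C (Cod C f)) (R f)) = Idt C (E_ob f)"
  by (rule E_eqI[of f]) (use assms in \<open>simp_all add: kappa_unit\<close>)

text \<open>Composed with \<open>S (R (R f)) \<cdot> far M (alpha (R f))\<close>, both sides become
  \<open>kappa f \<cdot> \<iota> (J_ob (R f))\<close>: on the left \<open>mu_alpha\<close> under
  \<open>M\<close> produces \<open>far M (kappa f)\<close>, and naturality of \<open>\<iota>\<close>
  at \<open>kappa f\<close> applies.\<close>

lemma kappa_assoc:
  assumes f: "f \<in> Ar C"
  shows "kappa f \<cdot> J_ar (Sq (R (R f)) (mu_ar f) (Idt C (Cod C f)) (R f)) = kappa f \<cdot> kappa (R f)"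
proof -
  have sq: "Sq (R (R f)) (mu_ar f) (Idt C (Cod C f)) (R f) \<in> Ar (arrow_cat C)"
    using f by simp
  note [simp] = J_types[OF sq] comp_reassoc[OF J_S[OF sq]] comp_reassoc[OF T_J[OF sq]]
  show ?thesis
    by (rule JR_eqI[of "R f" "T f"])
      (use f \<iota>_natural[of "kappa f"] in \<open>simp_all add: M_eq[OF mu_alpha] del: square_iff\<close>)
qed

lemma mu_assoc:
  assumes f: "f \<in> Ar C"
  shows "mu_ar f \<cdot> E_ar (Sq (R (R f)) (mu_ar f) (Idt C (Cod C f)) (R f)) = mu_ar f \<cdot> mu_ar (R f)"
proof -
  have sq: "Sq (R (R f)) (mu_ar f) (Idt C (Cod C f)) (R f) \<in> Ar (arrow_cat C)"
    using f by simp
  note [simp] = J_types[OF sq] E_types[OF sq]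
  show ?thesis
    by (rule E_eqI[of "R (R f)"]) (use f in \<open>simp_all add: kappa_assoc del: square_iff\<close>)
qed

section \<open>The laws of the comultiplication\<close>

text \<open>Composed with \<open>S f\<close>, both sides give
  \<open>S (L g) \<cdot> far M h\<close>; against \<open>T (L g)\<close> both give
  \<open>alpha g \<cdot> J_ar (Sq f h k g)\<close>. The other laws of \<open>delta\<close> are
  tested in the same way.\<close>

lemma delta_natural:
  assumes sq: "Sq f h k g \<in> Ar (arrow_cat C)"
  shows "J_ar (Sq (L f) h (E_ar (Sq f h k g)) (L g)) \<cdot> delta f = delta g \<cdot> J_ar (Sq f h k g)"
proof -
  let ?E = "E_ar (Sq f h k g)"
  have f: "f \<in> Ar C" "g \<in> Ar C" "h \<in> Ar C" "Dom C h = Dom C f" "Cod C h = Dom C g"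
    using sq by simp_all
  have sqL: "Sq (L f) h ?E (L g) \<in> Ar (arrow_cat C)"
    using sq by simp
  note [simp] = J_types[OF sq] E_types[OF sq] J_types[OF sqL] comp_reassoc[OF T_J[OF sqL]]
  show ?thesis
    by (rule J_eqI[of f "T (L g)"]) (use f in \<open>simp_all del: square_iff\<close>)
qed

lemma Delta_natural:
  assumes sq: "Sq f h k g \<in> Ar (arrow_cat C)"
  shows "E_ar (Sq (L f) h (E_ar (Sq f h k g)) (L g)) \<cdot> Delta_ar f = Delta_ar g \<cdot> E_ar (Sq f h k g)"
proof -
  let ?E = "E_ar (Sq f h k g)"
  have f: "f \<in> Ar C" "g \<in> Ar C" "h \<in> Ar C" "Dom C h = Dom C f" "Cod C h = Dom C g"
    using sq by simp_all
  have sqL: "Sq (L f) h ?E (L g) \<in> Ar (arrow_cat C)"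
    using sq by simp
  note [simp] = J_types[OF sq] E_types[OF sq] J_types[OF sqL] E_types[OF sqL] delta_natural[OF sq]
    comp_reassoc[OF E_alpha[OF sqL]]
  show ?thesis
    by (rule E_eqI[of f]) (use f in \<open>simp_all del: square_iff\<close>)
qed

lemma delta_counit:
  assumes "f \<in> Ar C"
  shows "J_ar (Sq (L f) (Idt C (Dom C f)) (R f) f) \<cdot> delta f = Idt C (J_ob f)"
  by (rule J_eqI[of f "T f"]) (use assms in simp_all)

lemma Delta_counit:
  assumes "f \<in> Ar C"
  shows "E_ar (Sq (L f) (Idt C (Dom C f)) (R f) f) \<cdot> Delta_ar f = Idt C (E_ob f)"
  by (rule E_eqI[of f]) (use assms in \<open>simp_all add: delta_counit\<close>)

text \<open>Against \<open>T (L (L f))\<close> the left side becomes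
  \<open>Delta_ar f \<cdot> alpha f\<close>, so \<open>Delta_alpha\<close> is what makes the two
  sides agree.\<close>

lemma delta_coassoc:
  assumes "f \<in> Ar C"
  shows "J_ar (Sq (L f) (Idt C (Dom C f)) (Delta_ar f) (L (L f))) \<cdot> delta f = delta (L f) \<cdot> delta f"
  by (rule J_eqI[of f "T (L (L f))"]) (use assms in simp_all)

lemma Delta_coassoc:
  assumes "f \<in> Ar C"
  shows "E_ar (Sq (L f) (Idt C (Dom C f)) (Delta_ar f) (L (L f))) \<cdot> Delta_ar f =
    Delta_ar (L f) \<cdot> Delta_ar f"
  by (rule E_eqI[of f]) (use assms in \<open>simp_all add: delta_coassoc\<close>)

section \<open>Compatibility of multiplication and comultiplication\<close>

text \<open>Composed with \<open>S (R f) \<cdot> far M (alpha f)\<close>, both sides become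
  \<open>delta f \<cdot> \<iota> (J_ob f)\<close>: \<open>Delta_alpha\<close> under \<open>M\<close>
  brings in \<open>far M (alpha (L f))\<close>, so that \<open>kappa_S\<close> at \<open>L f\<close>
  applies. Against \<open>T (L f)\<close> both become \<open>alpha f \<cdot> kappa f\<close>, on the
  left through \<open>mu_alpha\<close>.\<close>

lemma kappa_delta:
  assumes f: "f \<in> Ar C"
  shows "kappa (L f) \<cdot> (J_ar (Sq (L (R f)) (Delta_ar f) (mu_ar f) (R (L f))) \<cdot> delta (R f)) =
    delta f \<cdot> kappa f"
proof -
  have sq: "Sq (L (R f)) (Delta_ar f) (mu_ar f) (R (L f)) \<in> Ar (arrow_cat C)"
    using f by simp
  note [simp] = J_types[OF sq] comp_reassoc[OF J_S[OF sq]] comp_reassoc[OF T_J[OF sq]]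
  show ?thesis
    by (rule JR_eqI[of f "T (L f)"])
      (use f \<iota>_natural[of "delta f"] in \<open>simp_all add: M_eq[OF Delta_alpha] del: square_iff\<close>)
qed

text \<open>One equation serves two axioms of the distributive law: it is the upper side of
  \<open>law_mult\<close> and the lower side of \<open>law_comult\<close>.\<close>

lemma mu_Delta:
  assumes f: "f \<in> Ar C"
  shows "mu_ar (L f) \<cdot> (E_ar (Sq (L (R f)) (Delta_ar f) (mu_ar f) (R (L f))) \<cdot> Delta_ar (R f)) =
    Delta_ar f \<cdot> mu_ar f"
proof -
  have sq: "Sq (L (R f)) (Delta_ar f) (mu_ar f) (R (L f)) \<in> Ar (arrow_cat C)"
    using f by simp
  note [simp] = J_types[OF sq] E_types[OF sq] comp_reassoc[OF E_L[OF sq]] comp_reassoc[OF E_alpha[OF sq]]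
  show ?thesis
    by (rule E_eqI[of "R f"]) (use f in \<open>simp_all add: kappa_delta del: square_iff\<close>)
qed

section \<open>Assembly of the algebraic weak factorisation system\<close>

lemma LER_simps [simp]:
  "fob LER f = (L f, R f)"
  "far LER (Sq f h k g) = Lad (L f, R f) h (E_ar (Sq f h k g)) k (L g, R g)"
  "fob (left_ftor LER) f = L f"
  "far (left_ftor LER) (Sq f h k g) = Sq (L f) h (E_ar (Sq f h k g)) (L g)"
  "fob (right_ftor LER) f = R f"
  "far (right_ftor LER) (Sq f h k g) = Sq (R f) (E_ar (Sq f h k g)) k (R g)"
  by (simp_all add: LER_def left_ftor_def right_ftor_def first_ftor_def second_ftor_def comp_ftor_def)

lemma awfs_components [simp]:
  "left_counit C LER f = Sq (L f) (Idt C (Dom C f)) (R f) f"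
  "right_unit C LER f = Sq f (L f) (Idt C (Cod C f)) (R f)"
  "fob id_ftor A = A" "far id_ftor s = s"
  "fob (G \<circ>\<^sub>F F) A = fob G (fob F A)" "far (G \<circ>\<^sub>F F) s = far G (far F s)"
  by (simp_all add: left_counit_def right_unit_def id_ftor_def comp_ftor_def)

lemma LER_functor: "is_functor (arrow_cat C) (pair_cat C) LER"
proof (intro is_functor.intro is_functor_axioms.intro category_arrow_cat category_pair_cat)
  fix s assume "s \<in> Ar (arrow_cat C)"
  then show "far LER s \<in> hom (pair_cat C) (fob LER (Dom (arrow_cat C) s)) (fob LER (Cod (arrow_cat C) s))"
    by (elim arrow_cat_cases) (simp add: hom_def)
next
  fix s t assume "s \<in> Ar (arrow_cat C)" "t \<in> Ar (arrow_cat C)"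
    and eq: "Cod (arrow_cat C) s = Dom (arrow_cat C) t"
  then obtain f h k g h' k' g' where "s = Sq f h k g" "t = Sq g h' k' g'"
    and "Sq f h k g \<in> Ar (arrow_cat C)" "Sq g h' k' g' \<in> Ar (arrow_cat C)"
    by (cases s; cases t) (simp del: square_iff)
  then show "far LER (t \<cdot>\<^bsub>arrow_cat C\<^esub> s) = far LER t \<cdot>\<^bsub>pair_cat C\<^esub> far LER s"
    by (simp add: E_comp del: square_iff)
qed (simp_all add: E_ident)

lemma functorial: "functorial_factorisation C LER"
proof (intro functorial_factorisation.intro functorial_factorisation_axioms.intro
    LER_functor category_axioms)
  fix s assume "s \<in> Ar (arrow_cat C)"
  then show "far (composition_ftor C \<circ>\<^sub>F LER) s = s"
    by (elim arrow_cat_cases) (simp add: composition_ftor_def)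
qed (simp add: composition_ftor_def)

lemma left_functor: "is_functor (arrow_cat C) (arrow_cat C) (left_ftor LER)"
  unfolding left_ftor_def by (rule is_functor_comp[OF LER_functor is_functor_first])

lemma right_functor: "is_functor (arrow_cat C) (arrow_cat C) (right_ftor LER)"
  unfolding right_ftor_def by (rule is_functor_comp[OF LER_functor is_functor_second])

lemma left_comonad: "comonad (arrow_cat C) (left_ftor LER) (left_counit C LER) Delta"
proof (intro comonad.intro nat_trans.intro nat_trans_axioms.intro comonad_axioms.intro
    left_functor is_functor_comp[OF left_functor left_functor] is_functor_id category_arrow_cat)
  fix s assume "s \<in> Ar (arrow_cat C)"
  then show "far id_ftor s \<cdot>\<^bsub>arrow_cat C\<^esub> left_counit C LER (Dom (arrow_cat C) s) =
      left_counit C LER (Cod (arrow_cat C) s) \<cdot>\<^bsub>arrow_cat C\<^esub> far (left_ftor LER) s"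
    by (elim arrow_cat_cases) simp
next
  fix s assume "s \<in> Ar (arrow_cat C)"
  then show "far (left_ftor LER \<circ>\<^sub>F left_ftor LER) s \<cdot>\<^bsub>arrow_cat C\<^esub> Delta (Dom (arrow_cat C) s) =
      Delta (Cod (arrow_cat C) s) \<cdot>\<^bsub>arrow_cat C\<^esub> far (left_ftor LER) s"
    by (elim arrow_cat_cases) (simp add: Delta_def Delta_natural)
qed (simp_all add: hom_squares Delta_def Delta_counit Delta_coassoc)

lemma right_monad: "monad (arrow_cat C) (right_ftor LER) (right_unit C LER) mu"
proof (intro monad.intro nat_trans.intro nat_trans_axioms.intro monad_axioms.intro
    right_functor is_functor_comp[OF right_functor right_functor] is_functor_id category_arrow_cat)
  fix s assume "s \<in> Ar (arrow_cat C)"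
  then show "far (right_ftor LER) s \<cdot>\<^bsub>arrow_cat C\<^esub> right_unit C LER (Dom (arrow_cat C) s) =
      right_unit C LER (Cod (arrow_cat C) s) \<cdot>\<^bsub>arrow_cat C\<^esub> far id_ftor s"
    by (elim arrow_cat_cases) simp
next
  fix s assume "s \<in> Ar (arrow_cat C)"
  then show "far (right_ftor LER) s \<cdot>\<^bsub>arrow_cat C\<^esub> mu (Dom (arrow_cat C) s) =
      mu (Cod (arrow_cat C) s) \<cdot>\<^bsub>arrow_cat C\<^esub> far (right_ftor LER \<circ>\<^sub>F right_ftor LER) s"
    by (elim arrow_cat_cases) (simp add: mu_def mu_natural)
qed (simp_all add: hom_squares mu_def mu_unit mu_assoc)

text \<open>Each axiom is an equation of squares, checked on the two sides separately. Naturality is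
  that of \<open>Delta_ar\<close> above and of \<open>mu_ar\<close> below. Besides
  \<open>mu_Delta\<close>, \<open>law_mult\<close> needs \<open>mu_assoc\<close> below and
  \<open>law_comult\<close> needs \<open>Delta_coassoc\<close> above; \<open>law_unit\<close> rests
  on \<open>Delta_L\<close> and \<open>mu_unit\<close>, and \<open>law_counit\<close> on
  \<open>Delta_counit\<close> and \<open>R_mu\<close>.\<close>

lemma distributive:
  "distributive_law (arrow_cat C) (left_ftor LER) (left_counit C LER) Delta
    (right_ftor LER) (right_unit C LER) mu
    (\<lambda>f. Sq (L (R f)) (Delta_ar f) (mu_ar f) (R (L f)))"
    (is "distributive_law _ _ _ _ _ _ _ ?law")
proof (intro distributive_law.intro nat_trans.intro nat_trans_axioms.intro distributive_law_axioms.intro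
    left_comonad right_monad is_functor_comp[OF left_functor right_functor]
    is_functor_comp[OF right_functor left_functor])
  fix s assume "s \<in> Ar (arrow_cat C)"
  then show "far (right_ftor LER \<circ>\<^sub>F left_ftor LER) s \<cdot>\<^bsub>arrow_cat C\<^esub> ?law (Dom (arrow_cat C) s) =
      ?law (Cod (arrow_cat C) s) \<cdot>\<^bsub>arrow_cat C\<^esub> far (left_ftor LER \<circ>\<^sub>F right_ftor LER) s"
    by (elim arrow_cat_cases) (simp add: Delta_natural mu_natural)
qed (simp_all add: hom_squares mu_def Delta_def mu_unit mu_assoc Delta_counit Delta_coassoc mu_Delta)

lemma awfs: "awfs C LER Delta mu"
  using left_comonad right_monad distributive
  \<comment> \<open>Unfolding identifies \<open>sq_bot (Delta f)\<close> and
    \<open>sq_top (mu f)\<close> in the \<open>awfs\<close> axiom with \<open>Delta_ar f\<close> and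
    \<open>mu_ar f\<close>.\<close>
  by (intro awfs.intro awfs_axioms.intro functorial) (simp_all add: mu_def Delta_def)

end

theorem theorem29:
  fixes C :: "('o, 'm) cat"
    and EE MM :: "'m set"
    and e_part m_part :: "'m \<Rightarrow> 'm"
    and inj_l inj_r :: "'m \<Rightarrow> 'm \<Rightarrow> 'm"
    and M :: "('o, 'm, 'o, 'm) ftor"
    and \<iota> :: "'o \<Rightarrow> 'm"
  assumes "category C"
    and "chosen_pushouts C inj_l inj_r"
    and "orthogonal_factorisation_system C EE MM"
    and "chosen_factorisations C EE MM e_part m_part"
    and "idempotent_comonad C M \<iota>"
    and "preserves_pushouts C C M"
  shows "awfs C
    (awfs_construction.LER C e_part m_part inj_l inj_r M \<iota>)
    (awfs_construction.Delta C e_part m_part inj_l inj_r \<iota>)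
    (awfs_construction.mu C e_part m_part inj_l inj_r M \<iota>)"
  by (rule awfs_setting.awfs[of C EE MM])
    (intro awfs_setting.intro awfs_setting_axioms.intro assms)

end
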